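(* Let $\Lambda$ be a connected $k$-graph and $x\in\Lambda^0$. Then there is a cocycle $\eta:\Lambda\to\pi(\Lambda,x)$ such that the skew-product covering $\Lambda\times_\eta\pi(\Lambda,x)\to\Lambda$ is universal.
   Context: A $k$-graph is a small category $\Lambda$ with a functor $d:\Lambda\to\mathbb N^k$ (the degree) satisfying the factorization property: if $d(\alpha)=n+l$ with $n,l\in\mathbb N^k$, there are unique $\beta,\gamma\in\Lambda$ with $d(\beta)=n$, $d(\gamma)=l$, $\alpha=\beta\gamma$. $\Lambda^0$ is the set of objects (vertices, identified with identity morphisms); $s(\alpha)$ and $r(\alpha)$ are the domain and codomain of $\alpha$. $u\mathcal C=r^{-1}(u)$, $\mathcal C v=s^{-1}(v)$, $u\mathcal Cv=u\mathcal C\cap\mathcal Cv$. A small category $\mathcal C$ is connected if the equivalence relation on $\mathcal C^0$ generated by $\{(u,v)\mid u\mathcal Cv\neq\emptyset\}$ is all of $\mathcal C^0\times\mathcal C^0$. A $k$-graph morphism is a degree-preserving functor. A covering of $\Lambda$ is a surjective $k$-graph morphism $p:\Omega\to\Lambda$ such that for all $v\in\Omega^0$, $p$ maps $\Omega v$ bijectively onto $\Lambda p(v)$ and $v\Omega$ bijectively onto $p(v)\Lambda$. It is connected if $\Omega$ is connected. A morphism of coverings $(\Omega,p)\to(\Sigma,q)$ of $\Lambda$ is a $k$-graph morphism $\phi:\Omega\to\Sigma$ with $q\circ\phi=p$. A covering $(\Omega,p)$ is universal if it is connected and for every connected covering $(\Sigma,q)$ of $\Lambda$ there is a morphism $(\Omega,p)\to(\Sigma,q)$.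 The fundamental groupoid of $\Lambda$ is the groupoid $\mathcal G(\Lambda)$ with $\mathcal G(\Lambda)^0=\Lambda^0$, together with a functor $i:\Lambda\to\mathcal G(\Lambda)$ that is the identity on $\Lambda^0$, such that every functor from $\Lambda$ to a groupoid factors uniquely through $i$. The fundamental group at $x\in\Lambda^0$ is $\pi(\Lambda,x)=x\mathcal G(\Lambda)x$. A cocycle on $\Lambda$ is a functor $\eta:\Lambda\to G$ to a group $G$. The skew product $\Lambda\times_\eta G$ is the set $\Lambda\times G$ made into a $k$-graph by $s(\alpha,g)=(s(\alpha),g)$, $r(\alpha,g)=(r(\alpha),\eta(\alpha)g)$, $(\alpha,\eta(\beta)g)(\beta,g)=(\alpha\beta,g)$, $d(\alpha,g)=d(\alpha)$; the skew-product covering is the coordinate projection $\Lambda\times_\eta G\to\Lambda$. *)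

theory Defs
  imports "HOL-Algebra.Group" "HOL-Library.FuncSet" "HOL-Library.Function_Algebras"
begin

section \<open>Small categories, groupoids and functors\<close>

text \<open>A small category is given by its set of morphisms, objects being identified with identity
  morphisms. The product of \<open>a\<close> and \<open>b\<close> is defined when \<open>Src a = Rng b\<close>. The record fields are total
  functions; their values outside the morphism set (or on non-composable pairs) are irrelevant.\<close>

record 'a category =
  Arr :: "'a set"
  Src :: "'a \<Rightarrow> 'a"
  Rng :: "'a \<Rightarrow> 'a"
  Cmp :: "'a \<Rightarrow> 'a \<Rightarrow> 'a"

definition Obj :: "('a, 'b) category_scheme \<Rightarrow> 'a set" where
  "Obj C = {v \<in> Arr C. Src C v = v}"

locale small_category =
  fixes C :: "('a, 'b) category_scheme"
  assumes src_arr: "a \<in> Arr C \<Longrightarrow> Src C a \<in> Arr C"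
    and rng_arr: "a \<in> Arr C \<Longrightarrow> Rng C a \<in> Arr C"
    and src_src: "a \<in> Arr C \<Longrightarrow> Src C (Src C a) = Src C a"
    and rng_src: "a \<in> Arr C \<Longrightarrow> Rng C (Src C a) = Src C a"
    and src_rng: "a \<in> Arr C \<Longrightarrow> Src C (Rng C a) = Rng C a"
    and rng_rng: "a \<in> Arr C \<Longrightarrow> Rng C (Rng C a) = Rng C a"
    and cmp_arr: "a \<in> Arr C \<Longrightarrow> b \<in> Arr C \<Longrightarrow> Src C a = Rng C b \<Longrightarrow> Cmp C a b \<in> Arr C"
    and src_cmp: "a \<in> Arr C \<Longrightarrow> b \<in> Arr C \<Longrightarrow> Src C a = Rng C b \<Longrightarrow> Src C (Cmp C a b) = Src C b"
    and rng_cmp: "a \<in> Arr C \<Longrightarrow> b \<in> Arr C \<Longrightarrow> Src C a = Rng C b \<Longrightarrow> Rng C (Cmp C a b) = Rng C a"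
    and cmp_src: "a \<in> Arr C \<Longrightarrow> Cmp C a (Src C a) = a"
    and cmp_rng: "a \<in> Arr C \<Longrightarrow> Cmp C (Rng C a) a = a"
    and cmp_assoc: "a \<in> Arr C \<Longrightarrow> b \<in> Arr C \<Longrightarrow> c \<in> Arr C \<Longrightarrow> Src C a = Rng C b \<Longrightarrow> Src C b = Rng C c
      \<Longrightarrow> Cmp C (Cmp C a b) c = Cmp C a (Cmp C b c)"

locale groupoid = small_category +
  assumes ex_inverse: "a \<in> Arr C \<Longrightarrow> \<exists>b \<in> Arr C. Src C b = Rng C a \<and> Rng C b = Src C a \<and>
    Cmp C b a = Src C a \<and> Cmp C a b = Rng C a"

definition is_functor ::
  "('a, 'b) category_scheme \<Rightarrow> ('c, 'd) category_scheme \<Rightarrow> ('a \<Rightarrow> 'c) \<Rightarrow> bool" where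
  "is_functor C D F \<longleftrightarrow>
     (\<forall>a \<in> Arr C. F a \<in> Arr D \<and> F (Src C a) = Src D (F a) \<and> F (Rng C a) = Rng D (F a)) \<and>
     (\<forall>a \<in> Arr C. \<forall>b \<in> Arr C. Src C a = Rng C b \<longrightarrow> F (Cmp C a b) = Cmp D (F a) (F b))"

definition connected_category :: "('a, 'b) category_scheme \<Rightarrow> bool" where
  "connected_category C \<longleftrightarrow>
     \<Inter> {E. equiv (Obj C) E \<and>
         {(u, v) \<in> Obj C \<times> Obj C. \<exists>a \<in> Arr C. Rng C a = u \<and> Src C a = v} \<subseteq> E} = Obj C \<times> Obj C"

definition monoid_category :: "('a, 'b) monoid_scheme \<Rightarrow> 'a category" where
  "monoid_category M =
     \<lparr>Arr = carrier M, Src = (\<lambda>_. \<one>\<^bsub>M\<^esub>), Rng = (\<lambda>_. \<one>\<^bsub>M\<^esub>), Cmp = (\<lambda>a b. a \<otimes>\<^bsub>M\<^esub> b)\<rparr>"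

definition vertex_group :: "('a, 'b) category_scheme \<Rightarrow> 'a \<Rightarrow> 'a monoid" where
  "vertex_group C x =
     \<lparr>carrier = {a \<in> Arr C. Rng C a = x \<and> Src C a = x}, mult = Cmp C, one = x\<rparr>"


section \<open>$k$-graphs and coverings\<close>

record 'a kgraph = "'a category" +
  Deg :: "'a \<Rightarrow> nat \<Rightarrow> nat"

text \<open>Elements of $\mathbf{N}^k$ are functions vanishing from index \<open>k\<close> on, with pointwise addition.\<close>

definition Nat_tuples :: "nat \<Rightarrow> (nat \<Rightarrow> nat) set" where
  "Nat_tuples k = {n. \<forall>i \<ge> k. n i = 0}"

locale k_graph = small_category \<Lambda> for k :: nat and \<Lambda> :: "('a, 'b) kgraph_scheme" +
  assumes degree_functor:
      "is_functor \<Lambda> (monoid_category \<lparr>carrier = Nat_tuples k, mult = (+), one = 0\<rparr>) (Deg \<Lambda>)"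
    and factorization: "\<alpha> \<in> Arr \<Lambda> \<Longrightarrow> n \<in> Nat_tuples k \<Longrightarrow> l \<in> Nat_tuples k \<Longrightarrow> Deg \<Lambda> \<alpha> = n + l \<Longrightarrow>
      \<exists>!(\<beta>, \<gamma>). \<beta> \<in> Arr \<Lambda> \<and> \<gamma> \<in> Arr \<Lambda> \<and> Src \<Lambda> \<beta> = Rng \<Lambda> \<gamma> \<and> Deg \<Lambda> \<beta> = n \<and> Deg \<Lambda> \<gamma> = l \<and> \<alpha> = Cmp \<Lambda> \<beta> \<gamma>"

definition kgraph_morphism ::
  "('a, 'b) kgraph_scheme \<Rightarrow> ('c, 'd) kgraph_scheme \<Rightarrow> ('a \<Rightarrow> 'c) \<Rightarrow> bool" where
  "kgraph_morphism \<Omega> \<Lambda> p \<longleftrightarrow> is_functor \<Omega> \<Lambda> p \<and> (\<forall>\<omega> \<in> Arr \<Omega>. Deg \<Lambda> (p \<omega>) = Deg \<Omega> \<omega>)"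

definition covering ::
  "nat \<Rightarrow> ('a, 'b) kgraph_scheme \<Rightarrow> ('c, 'd) kgraph_scheme \<Rightarrow> ('c \<Rightarrow> 'a) \<Rightarrow> bool" where
  "covering k \<Lambda> \<Omega> p \<longleftrightarrow> k_graph k \<Omega> \<and> kgraph_morphism \<Omega> \<Lambda> p \<and> p ` Arr \<Omega> = Arr \<Lambda> \<and>
     (\<forall>v \<in> Obj \<Omega>.
        bij_betw p {\<omega> \<in> Arr \<Omega>. Src \<Omega> \<omega> = v} {\<alpha> \<in> Arr \<Lambda>. Src \<Lambda> \<alpha> = p v} \<and>
        bij_betw p {\<omega> \<in> Arr \<Omega>. Rng \<Omega> \<omega> = v} {\<alpha> \<in> Arr \<Lambda>. Rng \<Lambda> \<alpha> = p v})"

definition connected_covering ::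
  "nat \<Rightarrow> ('a, 'b) kgraph_scheme \<Rightarrow> ('c, 'd) kgraph_scheme \<Rightarrow> ('c \<Rightarrow> 'a) \<Rightarrow> bool" where
  "connected_covering k \<Lambda> \<Omega> p \<longleftrightarrow> covering k \<Lambda> \<Omega> p \<and> connected_category \<Omega>"

definition covering_morphism ::
  "('c, 'd) kgraph_scheme \<Rightarrow> ('c \<Rightarrow> 'a) \<Rightarrow> ('e, 'f) kgraph_scheme \<Rightarrow> ('e \<Rightarrow> 'a) \<Rightarrow> ('c \<Rightarrow> 'e) \<Rightarrow> bool" where
  "covering_morphism \<Omega> p \<Sigma> q \<phi> \<longleftrightarrow> kgraph_morphism \<Omega> \<Sigma> \<phi> \<and> (\<forall>\<omega> \<in> Arr \<Omega>. q (\<phi> \<omega>) = p \<omega>)"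

text \<open>A definition cannot quantify over all types, so \<open>\<Sigma>\<close> ranges over the $k$-graphs whose morphisms
  are lists over \<open>bool \<times> 'a\<close>, read as words in morphisms of \<open>\<Lambda>\<close> and their formal inverses. Every
  connected covering of \<open>\<Lambda>\<close>, in whatever type, has a copy among these; \<open>universal_covering_any_type\<close>
  below shows that the restriction is immaterial.\<close>

type_synonym 'a signed_word = "(bool \<times> 'a) list"

definition universal_covering ::
  "nat \<Rightarrow> ('a, 'b) kgraph_scheme \<Rightarrow> ('c, 'd) kgraph_scheme \<Rightarrow> ('c \<Rightarrow> 'a) \<Rightarrow> bool" where
  "universal_covering k \<Lambda> \<Omega> p \<longleftrightarrow> connected_covering k \<Lambda> \<Omega> p \<and>
     (\<forall>(\<Sigma> :: 'a signed_word kgraph) q.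
        connected_covering k \<Lambda> \<Sigma> q \<longrightarrow> (\<exists>\<phi>. covering_morphism \<Omega> p \<Sigma> q \<phi>))"


section \<open>The fundamental groupoid\<close>

text \<open>Since objects are identity morphisms, the condition that \<open>\<G>\<close> and \<open>\<Lambda>\<close> have the same objects and
  that \<open>i\<close> is the identity on them says that \<open>i\<close> is a bijection from the identity morphisms of \<open>\<Lambda>\<close>
  onto those of \<open>\<G>\<close>; the vertex \<open>x\<close>, viewed in \<open>\<G>\<close>, is \<open>i x\<close>.

  Again \<open>\<H>\<close> has to range over the groupoids on a fixed type. The one chosen has room for \<open>\<G>\<close> and for
  every groupoid generated by an image of \<open>\<Lambda>\<close>; \<open>fundamental_groupoid_any_type\<close> below shows that the
  factorization property for groupoids of all types follows, and \<open>fundamental_groupoid_exists\<close> that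
  a fundamental groupoid exists. The condition \<open>K \<in> extensional (Arr \<G>)\<close> only fixes the irrelevant
  values of \<open>K\<close> outside \<open>\<G>\<close>.\<close>

definition fundamental_groupoid ::
  "('a, 'b) category_scheme \<Rightarrow> ('g, 'c) category_scheme \<Rightarrow> ('a \<Rightarrow> 'g) \<Rightarrow> bool" where
  "fundamental_groupoid \<Lambda> \<G> i \<longleftrightarrow>
     groupoid \<G> \<and> is_functor \<Lambda> \<G> i \<and> bij_betw i (Obj \<Lambda>) (Obj \<G>) \<and>
     (\<forall>(\<H> :: ('g + 'a signed_word) category) F. groupoid \<H> \<and> is_functor \<Lambda> \<H> F \<longrightarrow>
        (\<exists>!K. K \<in> extensional (Arr \<G>) \<and> is_functor \<G> \<H> K \<and> (\<forall>\<alpha> \<in> Arr \<Lambda>. K (i \<alpha>) = F \<alpha>)))"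

definition fundamental_group :: "('g, 'c) category_scheme \<Rightarrow> ('a \<Rightarrow> 'g) \<Rightarrow> 'a \<Rightarrow> 'g monoid" where
  "fundamental_group \<G> i x = vertex_group \<G> (i x)"


section \<open>Cocycles and skew products\<close>

definition cocycle ::
  "('a, 'b) category_scheme \<Rightarrow> ('g, 'c) monoid_scheme \<Rightarrow> ('a \<Rightarrow> 'g) \<Rightarrow> bool" where
  "cocycle \<Lambda> G \<eta> \<longleftrightarrow> group G \<and> is_functor \<Lambda> (monoid_category G) \<eta>"

definition skew_product ::
  "('a, 'b) kgraph_scheme \<Rightarrow> ('g, 'c) monoid_scheme \<Rightarrow> ('a \<Rightarrow> 'g) \<Rightarrow> ('a \<times> 'g) kgraph" where
  "skew_product \<Lambda> G \<eta> =
     \<lparr>Arr = Arr \<Lambda> \<times> carrier G,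
      Src = (\<lambda>(\<alpha>, g). (Src \<Lambda> \<alpha>, g)),
      Rng = (\<lambda>(\<alpha>, g). (Rng \<Lambda> \<alpha>, \<eta> \<alpha> \<otimes>\<^bsub>G\<^esub> g)),
      Cmp = (\<lambda>(\<alpha>, h) (\<beta>, g). (Cmp \<Lambda> \<alpha> \<beta>, g)),
      Deg = (\<lambda>(\<alpha>, g). Deg \<Lambda> \<alpha>)\<rparr>"


section \<open>Existence of the fundamental groupoid, and independence of the auxiliary types\<close>

subsection \<open>Transport along an injection\<close>

definition image_category :: "('a \<Rightarrow> 'b) \<Rightarrow> ('a, 'c) category_scheme \<Rightarrow> 'b category" where
  "image_category f C = (let g = inv_into (Arr C) f in
     \<lparr>Arr = f ` Arr C, Src = (\<lambda>a. f (Src C (g a))), Rng = (\<lambda>a. f (Rng C (g a))),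
      Cmp = (\<lambda>a b. f (Cmp C (g a) (g b)))\<rparr>)"

lemma image_category_simps:
  assumes "inj_on f (Arr C)"
  shows "Arr (image_category f C) = f ` Arr C"
    and "a \<in> Arr C \<Longrightarrow> Src (image_category f C) (f a) = f (Src C a)"
    and "a \<in> Arr C \<Longrightarrow> Rng (image_category f C) (f a) = f (Rng C a)"
    and "a \<in> Arr C \<Longrightarrow> b \<in> Arr C \<Longrightarrow> Cmp (image_category f C) (f a) (f b) = f (Cmp C a b)"
  using assms by (simp_all add: image_category_def Let_def)

lemma small_category_image:
  assumes "small_category C" "inj_on f (Arr C)"
  shows "small_category (image_category f C)"
proof -
  interpret small_category C by fact
  note [simp] = src_arr rng_arr src_src rng_src src_rng rng_rng cmp_arr src_cmp rng_cmp cmp_src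
    cmp_rng cmp_assoc image_category_simps[OF assms(2)] inj_on_eq_iff[OF assms(2)]
  show ?thesis by unfold_locales auto
qed

lemma groupoid_image:
  assumes "groupoid C" "inj_on f (Arr C)"
  shows "groupoid (image_category f C)"
proof -
  interpret groupoid C by fact
  interpret I: small_category "image_category f C"
    by (rule small_category_image) (fact small_category_axioms assms)+
  note [simp] = src_arr rng_arr cmp_arr image_category_simps[OF assms(2)] inj_on_eq_iff[OF assms(2)]
  show ?thesis
  proof
    fix a assume "a \<in> Arr (image_category f C)"
    then obtain c where c: "c \<in> Arr C" "a = f c" by auto
    from ex_inverse[OF c(1)] obtain b where "b \<in> Arr C" "Src C b = Rng C c" "Rng C b = Src C c"
      "Cmp C b c = Src C c" "Cmp C c b = Rng C c" by blast
    with c show "\<exists>b\<in>Arr (image_category f C). Src (image_category f C) b = Rng (image_category f C) a \<and>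
        Rng (image_category f C) b = Src (image_category f C) a \<and>
        Cmp (image_category f C) b a = Src (image_category f C) a \<and>
        Cmp (image_category f C) a b = Rng (image_category f C) a"
      by (intro bexI[of _ "f b"]) auto
  qed
qed

lemma functor_image:
  assumes "small_category C" "inj_on f (Arr C)"
  shows "is_functor C (image_category f C) f"
    and "is_functor (image_category f C) C (inv_into (Arr C) f)"
proof -
  interpret small_category C by fact
  note [simp] = src_arr rng_arr cmp_arr image_category_simps[OF assms(2)] inj_on_eq_iff[OF assms(2)]
     inv_into_f_f[OF assms(2)]
  show "is_functor C (image_category f C) f" "is_functor (image_category f C) C (inv_into (Arr C) f)"
    by (auto simp: is_functor_def)
qed

lemma functor_comp:
  "is_functor C D F \<Longrightarrow> is_functor D E G \<Longrightarrow> is_functor C E (G \<circ> F)"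
  unfolding is_functor_def comp_def by metis

lemma functor_cong:
  assumes "small_category C" "\<And>a. a \<in> Arr C \<Longrightarrow> F a = G a"
  shows "is_functor C D F = is_functor C D G"
proof -
  interpret small_category C by fact
  show ?thesis using assms(2) src_arr rng_arr cmp_arr by (simp add: is_functor_def)
qed


subsection \<open>Words\<close>

text \<open>In a word, \<open>(True, a)\<close> stands for \<open>a\<close> and \<open>(False, a)\<close> for its formal inverse; \<open>word_path C u l v\<close>
  says that \<open>l\<close> is a composable word with range \<open>u\<close> and source \<open>v\<close>. Morphisms of the word groupoid are
  classes of such words, represented by a chosen member.\<close>

primrec word_path :: "('a, 'b) category_scheme \<Rightarrow> 'a \<Rightarrow> 'a signed_word \<Rightarrow> 'a \<Rightarrow> bool" where
  "word_path C u [] v \<longleftrightarrow> u \<in> Obj C \<and> u = v"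
| "word_path C u (x # l) v \<longleftrightarrow> snd x \<in> Arr C \<and>
     (if fst x then Rng C (snd x) = u \<and> word_path C (Src C (snd x)) l v
      else Src C (snd x) = u \<and> word_path C (Rng C (snd x)) l v)"

inductive word_equiv :: "('a, 'b) category_scheme \<Rightarrow> 'a \<Rightarrow> 'a signed_word \<Rightarrow> 'a signed_word \<Rightarrow> 'a \<Rightarrow> bool"
  for C where
  refl: "word_path C u l v \<Longrightarrow> word_equiv C u l l v"
| sym: "word_equiv C u l l' v \<Longrightarrow> word_equiv C u l' l v"
| trans: "word_equiv C u l l' v \<Longrightarrow> word_equiv C u l' l'' v \<Longrightarrow> word_equiv C u l l'' v"
| append: "word_equiv C u l l' v \<Longrightarrow> word_equiv C v m m' w \<Longrightarrow> word_equiv C u (l @ m) (l' @ m') w"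
| identity: "v \<in> Obj C \<Longrightarrow> word_equiv C v [(True, v)] [] v"
| comp: "a \<in> Arr C \<Longrightarrow> b \<in> Arr C \<Longrightarrow> Src C a = Rng C b \<Longrightarrow>
    word_equiv C (Rng C a) [(True, Cmp C a b)] [(True, a), (True, b)] (Src C b)"
| right_inverse: "a \<in> Arr C \<Longrightarrow> word_equiv C (Rng C a) [(True, a), (False, a)] [] (Rng C a)"
| left_inverse: "a \<in> Arr C \<Longrightarrow> word_equiv C (Src C a) [(False, a), (True, a)] [] (Src C a)"

definition word_rep :: "('a, 'b) category_scheme \<Rightarrow> 'a \<Rightarrow> 'a signed_word \<Rightarrow> 'a \<Rightarrow> 'a signed_word" where
  "word_rep C u l v = (SOME l'. word_equiv C u l l' v)"

definition word_groupoid :: "('a, 'b) category_scheme \<Rightarrow> ('a \<times> 'a signed_word \<times> 'a) category" where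
  "word_groupoid C =
     \<lparr>Arr = {(u, word_rep C u l v, v) |u l v. word_path C u l v},
      Src = (\<lambda>(u, l, v). (v, word_rep C v [] v, v)),
      Rng = (\<lambda>(u, l, v). (u, word_rep C u [] u, u)),
      Cmp = (\<lambda>(u, l, v) (v', l', w). (u, word_rep C u (l @ l') w, w))\<rparr>"

definition word_embed :: "('a, 'b) category_scheme \<Rightarrow> 'a \<Rightarrow> 'a \<times> 'a signed_word \<times> 'a" where
  "word_embed C a = (Rng C a, word_rep C (Rng C a) [(True, a)] (Src C a), Src C a)"

definition word_inverse :: "'a signed_word \<Rightarrow> 'a signed_word" where
  "word_inverse l = rev (map (\<lambda>(b, a). (\<not> b, a)) l)"

context small_category
begin

lemma ObjI: "a \<in> Arr C \<Longrightarrow> Src C a \<in> Obj C" "a \<in> Arr C \<Longrightarrow> Rng C a \<in> Obj C"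
  by (simp_all add: Obj_def src_arr rng_arr src_src src_rng)

lemma ObjD: assumes "v \<in> Obj C" shows "v \<in> Arr C" "Src C v = v" "Rng C v = v"
  using assms rng_src[of v] by (auto simp: Obj_def)

lemma word_path_Obj: "word_path C u l v \<Longrightarrow> u \<in> Obj C \<and> v \<in> Obj C"
  by (induction l arbitrary: u) (auto split: if_splits simp: ObjI)

lemma word_path_append: "word_path C u l v \<Longrightarrow> word_path C v m w \<Longrightarrow> word_path C u (l @ m) w"
  by (induction l arbitrary: u) (auto split: if_splits)

lemma word_path_inverse: "word_path C u l v \<Longrightarrow> word_path C v (word_inverse l) u"
  unfolding word_inverse_def
  by (induction l arbitrary: u) (auto split: if_splits intro!: word_path_append simp: ObjI)

lemma word_equiv_path: "word_equiv C u l l' v \<Longrightarrow> word_path C u l v \<and> word_path C u l' v"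
  by (induction rule: word_equiv.induct)
    (auto simp: ObjD ObjI cmp_arr src_cmp rng_cmp word_path_append)

lemma word_equiv_rep: "word_path C u l v \<Longrightarrow> word_equiv C u l (word_rep C u l v) v"
  unfolding word_rep_def by (rule someI_ex) (blast intro: word_equiv.refl)

lemma word_rep_eq_iff:
  assumes "word_path C u l v" "word_path C u l' v"
  shows "word_rep C u l v = word_rep C u l' v \<longleftrightarrow> word_equiv C u l l' v"
proof
  assume "word_rep C u l v = word_rep C u l' v"
  then show "word_equiv C u l l' v"
    using word_equiv_rep[OF assms(1)] word_equiv_rep[OF assms(2)]
    by (metis word_equiv.sym word_equiv.trans)
next
  assume "word_equiv C u l l' v"
  then have "word_equiv C u l m v \<longleftrightarrow> word_equiv C u l' m v" for m
    by (metis word_equiv.sym word_equiv.trans)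
  then show "word_rep C u l v = word_rep C u l' v" by (simp add: word_rep_def)
qed

lemma word_rep_path: "word_path C u l v \<Longrightarrow> word_path C u (word_rep C u l v) v"
  using word_equiv_rep word_equiv_path by blast

lemma word_rep_rep:
  "word_path C u l v \<Longrightarrow> word_rep C u (word_rep C u l v) v = word_rep C u l v"
  by (simp add: word_rep_eq_iff word_rep_path word_equiv_rep word_equiv.sym)

lemma word_rep_append:
  assumes "word_path C u l v" "word_path C v m w"
  shows "word_rep C u (word_rep C u l v @ word_rep C v m w) w = word_rep C u (l @ m) w"
proof -
  have "word_equiv C u (l @ m) (word_rep C u l v @ word_rep C v m w) w"
    using word_equiv.append[OF word_equiv_rep[OF assms(1)] word_equiv_rep[OF assms(2)]] .
  then show ?thesis using word_rep_eq_iff word_equiv_path word_equiv.sym by metis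
qed

lemma word_inverse_equiv:
  "word_path C u l v \<Longrightarrow> word_equiv C u (l @ word_inverse l) [] u"
proof (induction l arbitrary: u)
  case Nil
  then show ?case by (auto simp: word_inverse_def intro: word_equiv.refl)
next
  case (Cons x l)
  obtain b a where x: "x = (b, a)" by force
  define t where "t = (if b then Src C a else Rng C a)"
  have t: "word_path C t l v" "word_path C u [(b, a)] t" "word_path C t [(\<not> b, a)] u" "a \<in> Arr C"
    using Cons.prems by (auto simp: x t_def ObjI split: if_splits)
  have "word_equiv C u ([(b, a)] @ (l @ word_inverse l) @ [(\<not> b, a)]) ([(b, a)] @ [] @ [(\<not> b, a)]) u"
    by (intro word_equiv.append[OF word_equiv.refl[OF t(2)]]
          word_equiv.append[OF _ word_equiv.refl[OF t(3)]] Cons.IH t)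
  also have "([(b, a)] @ (l @ word_inverse l) @ [(\<not> b, a)]) = (x # l) @ word_inverse (x # l)"
    by (simp add: word_inverse_def x)
  finally have 1: "word_equiv C u ((x # l) @ word_inverse (x # l)) [(b, a), (\<not> b, a)] u" by simp
  have 2: "word_equiv C u [(b, a), (\<not> b, a)] [] u"
    using t word_equiv.right_inverse[OF t(4)] word_equiv.left_inverse[OF t(4)] by (cases b) auto
  show ?case using word_equiv.trans[OF 1 2] .
qed

lemma word_inverse_inverse: "word_inverse (word_inverse l) = l"
  by (simp add: word_inverse_def rev_map comp_def case_prod_unfold)

lemma word_groupoid_simps:
  "word_path C u l v \<Longrightarrow> (u, word_rep C u l v, v) \<in> Arr (word_groupoid C)"
  "Src (word_groupoid C) (u, l, v) = (v, word_rep C v [] v, v)"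
  "Rng (word_groupoid C) (u, l, v) = (u, word_rep C u [] u, u)"
  "Cmp (word_groupoid C) (u, l, v) (v', l', w) = (u, word_rep C u (l @ l') w, w)"
  by (auto simp: word_groupoid_def)

lemma word_groupoid_Arr:
  assumes "A \<in> Arr (word_groupoid C)"
  obtains u l v where "A = (u, word_rep C u l v, v)" "word_path C u l v"
  using assms by (auto simp: word_groupoid_def)

lemma groupoid_word_groupoid: "groupoid (word_groupoid C)"
proof -
  note S = word_groupoid_simps word_path_Obj word_rep_append word_path_append word_rep_path
  have e: "word_path C u [] u" if "word_path C u l v \<or> word_path C v l u" for u l v
    using that word_path_Obj by auto
  show ?thesis
  proof
    fix a assume "a \<in> Arr (word_groupoid C)"
    then obtain u l v where a: "a = (u, word_rep C u l v, v)" and p: "word_path C u l v"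
      by (rule word_groupoid_Arr)
    have eu: "word_path C u [] u" and ev: "word_path C v [] v" using e p by blast+
    show "Src (word_groupoid C) a \<in> Arr (word_groupoid C)"
      using ev by (simp add: a word_groupoid_simps)
    show "Rng (word_groupoid C) a \<in> Arr (word_groupoid C)"
      using eu by (simp add: a word_groupoid_simps)
    show "Cmp (word_groupoid C) a (Src (word_groupoid C) a) = a"
      using word_rep_append[OF p ev] by (simp add: a word_groupoid_simps)
    show "Cmp (word_groupoid C) (Rng (word_groupoid C) a) a = a"
      using word_rep_append[OF eu p] by (simp add: a word_groupoid_simps)
    let ?i = "(v, word_rep C v (word_inverse l) u, u)"
    have q: "word_path C v (word_inverse l) u" using p by (rule word_path_inverse)
    have 1: "word_rep C u (l @ word_inverse l) u = word_rep C u [] u"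
      using word_inverse_equiv[OF p] word_rep_eq_iff word_equiv_path by blast
    have 2: "word_rep C v (word_inverse l @ l) v = word_rep C v [] v"
      using word_inverse_equiv[OF q] word_rep_eq_iff word_equiv_path
      unfolding word_inverse_inverse by blast
    show "\<exists>b\<in>Arr (word_groupoid C). Src (word_groupoid C) b = Rng (word_groupoid C) a \<and>
        Rng (word_groupoid C) b = Src (word_groupoid C) a \<and>
        Cmp (word_groupoid C) b a = Src (word_groupoid C) a \<and>
        Cmp (word_groupoid C) a b = Rng (word_groupoid C) a"
      by (rule bexI[of _ ?i])
        (simp_all add: a word_groupoid_simps word_rep_append[OF p q] word_rep_append[OF q p] 1 2 q)
  next
    fix a b assume "a \<in> Arr (word_groupoid C)" "b \<in> Arr (word_groupoid C)"
      and ab: "Src (word_groupoid C) a = Rng (word_groupoid C) b"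
    then obtain u l v v' m w where a: "a = (u, word_rep C u l v, v)" "word_path C u l v"
      and b: "b = (v', word_rep C v' m w, w)" "word_path C v' m w"
      by (metis word_groupoid_Arr)
    from ab have v: "v' = v" by (simp add: a b word_groupoid_simps)
    note p = a(2) b(2)[unfolded v]
    show "Cmp (word_groupoid C) a b \<in> Arr (word_groupoid C)"
      using word_groupoid_simps(1)[OF word_path_append[OF p]]
      by (simp add: a(1) b(1) v word_groupoid_simps(4) word_rep_append[OF p])
    show "Src (word_groupoid C) (Cmp (word_groupoid C) a b) = Src (word_groupoid C) b"
      "Rng (word_groupoid C) (Cmp (word_groupoid C) a b) = Rng (word_groupoid C) a"
      by (simp_all add: a b v word_groupoid_simps)
  next
    fix a b c assume "a \<in> Arr (word_groupoid C)" "b \<in> Arr (word_groupoid C)" "c \<in> Arr (word_groupoid C)"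
      and ab: "Src (word_groupoid C) a = Rng (word_groupoid C) b"
      and bc: "Src (word_groupoid C) b = Rng (word_groupoid C) c"
    then obtain u l v v' m w w' n z where a: "a = (u, word_rep C u l v, v)" "word_path C u l v"
      and b: "b = (v', word_rep C v' m w, w)" "word_path C v' m w"
      and c: "c = (w', word_rep C w' n z, z)" "word_path C w' n z"
      by (metis word_groupoid_Arr)
    from ab bc have v: "v' = v" "w' = w" by (simp_all add: a b c word_groupoid_simps)
    note p = a(2) b(2)[unfolded v] c(2)[unfolded v]
    show "Cmp (word_groupoid C) (Cmp (word_groupoid C) a b) c =
        Cmp (word_groupoid C) a (Cmp (word_groupoid C) b c)"
      using p by (simp add: a b c v word_groupoid_simps word_rep_append[OF p(1) p(2)]
          word_rep_append[OF p(2) p(3)]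
          word_rep_append[OF word_path_append[OF p(1) p(2)] p(3)]
          word_rep_append[OF p(1) word_path_append[OF p(2) p(3)]])
  qed (auto elim!: word_groupoid_Arr simp: word_groupoid_simps)
qed

lemma word_path_single: "a \<in> Arr C \<Longrightarrow> word_path C (Rng C a) [(True, a)] (Src C a)"
  by (simp add: ObjI)

lemma word_embed_Obj: "v \<in> Obj C \<Longrightarrow> word_embed C v = (v, word_rep C v [] v, v)"
  using word_equiv.identity[of v C]
  by (simp add: word_embed_def ObjD word_rep_eq_iff)

lemma word_embed_functor: "is_functor C (word_groupoid C) (word_embed C)"
  unfolding is_functor_def
proof (intro conjI ballI impI)
  fix a assume a: "a \<in> Arr C"
  show "word_embed C a \<in> Arr (word_groupoid C)"
    using word_path_single[OF a] by (simp only: word_embed_def word_groupoid_simps)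
  show "word_embed C (Src C a) = Src (word_groupoid C) (word_embed C a)"
    by (simp only: word_embed_Obj[OF ObjI(1)[OF a]]) (simp add: word_embed_def word_groupoid_simps)
  show "word_embed C (Rng C a) = Rng (word_groupoid C) (word_embed C a)"
    by (simp only: word_embed_Obj[OF ObjI(2)[OF a]]) (simp add: word_embed_def word_groupoid_simps)
next
  fix a b assume a: "a \<in> Arr C" and b: "b \<in> Arr C" and ab: "Src C a = Rng C b"
  have "word_rep C (Rng C a) [(True, Cmp C a b)] (Src C b) = word_rep C (Rng C a) [(True, a), (True, b)] (Src C b)"
    using word_equiv.comp[OF a b ab] word_rep_eq_iff word_equiv_path by blast
  then show "word_embed C (Cmp C a b) = Cmp (word_groupoid C) (word_embed C a) (word_embed C b)"
    using word_rep_append[OF word_path_single[OF a] word_path_single[OF b, folded ab]] a b ab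
    by (simp add: word_embed_def word_groupoid_simps src_cmp rng_cmp)
qed

lemma word_embed_bij: "bij_betw (word_embed C) (Obj C) (Obj (word_groupoid C))"
proof (rule bij_betw_imageI)
  show "inj_on (word_embed C) (Obj C)" by (rule inj_onI) (simp add: word_embed_Obj)
  have "A \<in> word_embed C ` Obj C" if A: "A \<in> Obj (word_groupoid C)" for A
  proof -
    from A have "A \<in> Arr (word_groupoid C)" by (simp add: Obj_def)
    then obtain u l v where a: "A = (u, word_rep C u l v, v)" "word_path C u l v"
      by (rule word_groupoid_Arr)
    have "A = Src (word_groupoid C) A" using A by (simp add: Obj_def)
    also have "\<dots> = (v, word_rep C v [] v, v)" by (simp only: a(1) word_groupoid_simps)
    finally have "A = (v, word_rep C v [] v, v)" .
    then show ?thesis using word_path_Obj[OF a(2)] word_embed_Obj[of v] by (metis image_eqI)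
  qed
  moreover have "word_embed C v \<in> Obj (word_groupoid C)" if "v \<in> Obj C" for v
    using word_groupoid_simps(1)[of v "[]" v] that
    by (simp add: word_embed_Obj Obj_def[of "word_groupoid C"] word_groupoid_simps(2))
  ultimately show "word_embed C ` Obj C = Obj (word_groupoid C)" by blast
qed

end

definition ginverse :: "('a, 'b) category_scheme \<Rightarrow> 'a \<Rightarrow> 'a" where
  "ginverse H a = (SOME b. b \<in> Arr H \<and> Src H b = Rng H a \<and> Rng H b = Src H a \<and>
     Cmp H b a = Src H a \<and> Cmp H a b = Rng H a)"

context groupoid
begin

lemma ginverse:
  assumes "a \<in> Arr C"
  shows "ginverse C a \<in> Arr C" "Src C (ginverse C a) = Rng C a" "Rng C (ginverse C a) = Src C a"
    "Cmp C (ginverse C a) a = Src C a" "Cmp C a (ginverse C a) = Rng C a"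
proof -
  have "\<exists>b. b \<in> Arr C \<and> Src C b = Rng C a \<and> Rng C b = Src C a \<and>
     Cmp C b a = Src C a \<and> Cmp C a b = Rng C a" using ex_inverse[OF assms] by blast
  from someI_ex[OF this] show "ginverse C a \<in> Arr C" "Src C (ginverse C a) = Rng C a" "Rng C (ginverse C a) = Src C a"
    "Cmp C (ginverse C a) a = Src C a" "Cmp C a (ginverse C a) = Rng C a"
    unfolding ginverse_def by blast+
qed

lemma ginverse_unique:
  assumes "a \<in> Arr C" "b \<in> Arr C" "Src C b = Rng C a" "Cmp C b a = Src C a"
  shows "b = ginverse C a"
proof -
  have "b = Cmp C b (Rng C a)" using assms(2,3) cmp_src[of b] by simp
  also have "\<dots> = Cmp C b (Cmp C a (ginverse C a))" by (simp add: ginverse assms)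
  also have "\<dots> = Cmp C (Cmp C b a) (ginverse C a)"
    using cmp_assoc[of b a "ginverse C a"] assms ginverse[OF assms(1)] by simp
  also have "\<dots> = ginverse C a" using assms(4) ginverse[OF assms(1)] cmp_rng[of "ginverse C a"] by simp
  finally show ?thesis .
qed

end

primrec word_eval :: "('h, 'c) category_scheme \<Rightarrow> ('a, 'b) category_scheme \<Rightarrow> ('a \<Rightarrow> 'h) \<Rightarrow> 'a signed_word \<Rightarrow> 'a \<Rightarrow> 'h" where
  "word_eval H C F [] v = F v"
| "word_eval H C F (x # l) v =
     Cmp H (if fst x then F (snd x) else ginverse H (F (snd x))) (word_eval H C F l v)"

lemma functorD:
  assumes "is_functor C D F"
  shows "a \<in> Arr C \<Longrightarrow> F a \<in> Arr D" "a \<in> Arr C \<Longrightarrow> F (Src C a) = Src D (F a)"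
    "a \<in> Arr C \<Longrightarrow> F (Rng C a) = Rng D (F a)"
    "a \<in> Arr C \<Longrightarrow> b \<in> Arr C \<Longrightarrow> Src C a = Rng C b \<Longrightarrow> F (Cmp C a b) = Cmp D (F a) (F b)"
  using assms by (auto simp: is_functor_def)

lemma word_eval_path:
  assumes "small_category C" "groupoid H" "is_functor C H F" "word_path C u l v"
  shows "word_eval H C F l v \<in> Arr H \<and> Rng H (word_eval H C F l v) = F u \<and> Src H (word_eval H C F l v) = F v"
proof -
  interpret C: small_category C by fact
  interpret H: groupoid H by fact
  note F = functorD[OF assms(3)]
  show ?thesis using assms(4)
  proof (induction l arbitrary: u)
    case Nil
    then have "v \<in> Arr C" "Src C v = v" "Rng C v = v" "u = v" using C.ObjD by auto
    then show ?case using F by (metis word_eval.simps(1))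
  next
    case (Cons x l)
    then show ?case
      by (auto split: if_splits simp: F H.ginverse H.cmp_arr H.src_cmp H.rng_cmp)
  qed
qed

lemma word_eval_append:
  assumes "small_category C" "groupoid H" "is_functor C H F" "word_path C u l v" "word_path C v m w"
  shows "word_eval H C F (l @ m) w = Cmp H (word_eval H C F l v) (word_eval H C F m w)"
proof -
  interpret C: small_category C by fact
  interpret H: groupoid H by fact
  note F = functorD[OF assms(3)]
  show ?thesis using assms(4)
  proof (induction l arbitrary: u)
    case Nil
    then show ?case using word_eval_path[OF assms(1-3,5)] H.cmp_rng by fastforce
  next
    case (Cons x l)
    define t where "t = (if fst x then Src C (snd x) else Rng C (snd x))"
    have t: "word_path C t l v" "snd x \<in> Arr C" using Cons.prems by (auto simp: t_def split: if_splits)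
    show ?case
      using Cons.IH[OF t(1)] word_eval_path[OF assms(1-3) t(1)] word_eval_path[OF assms(1-3,5)] t
      by (auto simp: F H.ginverse t_def H.cmp_assoc)
  qed
qed

lemma word_eval_single:
  assumes "small_category C" "groupoid H" "is_functor C H F" "a \<in> Arr C"
  shows "word_eval H C F [(True, a)] (Src C a) = F a"
    "word_eval H C F [(False, a)] (Rng C a) = ginverse H (F a)"
proof -
  interpret C: small_category C by fact
  interpret H: groupoid H by fact
  note F = functorD[OF assms(3)]
  show "word_eval H C F [(True, a)] (Src C a) = F a"
    "word_eval H C F [(False, a)] (Rng C a) = ginverse H (F a)"
    using assms(4) H.cmp_src[of "F a"] H.cmp_src[of "ginverse H (F a)"] by (auto simp: F H.ginverse)
qed

lemma word_eval_equiv: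
  assumes "small_category C" "groupoid H" "is_functor C H F" "word_equiv C u l l' v"
  shows "word_eval H C F l v = word_eval H C F l' v"
proof -
  interpret C: small_category C by fact
  interpret H: groupoid H by fact
  note F = functorD[OF assms(3)]
  show ?thesis using assms(4)
  proof (induction rule: word_equiv.induct)
    case (append u l l' v m m' w)
    then show ?case
      using word_eval_append[OF assms(1-3)] C.word_equiv_path by metis
  next
    case (identity v)
    then show ?case using word_eval_single(1)[OF assms(1-3), of v] C.ObjD[of v] by simp
  next
    case (comp a b)
    have "word_eval H C F [(True, Cmp C a b)] (Src C b) = F (Cmp C a b)"
      using word_eval_single(1)[OF assms(1-3) C.cmp_arr[OF comp]] C.src_cmp[OF comp] by simp
    then show ?case using word_eval_single(1)[OF assms(1-3), of b] comp by (simp add: F)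
  next
    case (right_inverse a)
    then show ?case using word_eval_single(2)[OF assms(1-3), of a] by (simp add: H.ginverse F)
  next
    case (left_inverse a)
    then show ?case using word_eval_single(1)[OF assms(1-3), of a] by (simp add: H.ginverse F)
  qed auto
qed

lemma word_groupoid_factor:
  assumes "small_category C" "groupoid H" "is_functor C H F"
  shows "\<exists>K. is_functor (word_groupoid C) H K \<and> (\<forall>a \<in> Arr C. K (word_embed C a) = F a)"
proof -
  interpret C: small_category C by fact
  interpret H: groupoid H by fact
  note F = functorD[OF assms(3)]
  define K where "K = (\<lambda>(u :: 'a, l, v). word_eval H C F l v)"
  have K: "K (u, word_rep C u l v, v) = word_eval H C F l v" if "word_path C u l v" for u l v
    using word_eval_equiv[OF assms(1-3) C.word_equiv_rep[OF that]] by (simp add: K_def)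
  have "is_functor (word_groupoid C) H K"
    unfolding is_functor_def
  proof (intro conjI ballI impI)
    fix a assume "a \<in> Arr (word_groupoid C)"
    then obtain u l v where a: "a = (u, word_rep C u l v, v)" and p: "word_path C u l v"
      by (rule C.word_groupoid_Arr)
    have e: "word_path C u [] u" "word_path C v [] v" using C.word_path_Obj[OF p] by auto
    show "K a \<in> Arr H" "K (Src (word_groupoid C) a) = Src H (K a)" "K (Rng (word_groupoid C) a) = Rng H (K a)"
      using word_eval_path[OF assms(1-3) p] K[OF e(1)] K[OF e(2)]
      by (simp_all add: a C.word_groupoid_simps K[OF p])
  next
    fix a b assume "a \<in> Arr (word_groupoid C)" "b \<in> Arr (word_groupoid C)"
      and ab: "Src (word_groupoid C) a = Rng (word_groupoid C) b"
    then obtain u l v v' m w where a: "a = (u, word_rep C u l v, v)" "word_path C u l v"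
      and b: "b = (v', word_rep C v' m w, w)" "word_path C v' m w"
      by (metis C.word_groupoid_Arr)
    from ab have v: "v' = v" by (simp add: a b C.word_groupoid_simps)
    note p = a(2) b(2)[unfolded v]
    show "K (Cmp (word_groupoid C) a b) = Cmp H (K a) (K b)"
      by (simp add: a(1) b(1) v C.word_groupoid_simps C.word_rep_append[OF p] K p
          C.word_path_append[OF p] word_eval_append[OF assms(1-3) p])
  qed
  moreover have "K (word_embed C a) = F a" if "a \<in> Arr C" for a
    using K[OF C.word_path_single[OF that]] word_eval_single(1)[OF assms that] by (simp add: word_embed_def)
  ultimately show ?thesis by blast
qed

lemma functor_ginverse:
  assumes "groupoid C" "groupoid H" "is_functor C H K" "a \<in> Arr C"
  shows "K (ginverse C a) = ginverse H (K a)"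
proof -
  interpret C: groupoid C by fact
  interpret H: groupoid H by fact
  note K = functorD[OF assms(3)]
  show ?thesis using assms(4) C.ginverse[OF assms(4)] K
    by (intro H.ginverse_unique) (metis K)+
qed

lemma word_groupoid_unique:
  assumes "small_category C" "groupoid H"
    and "is_functor (word_groupoid C) H K" "is_functor (word_groupoid C) H K'"
    and eq: "\<And>a. a \<in> Arr C \<Longrightarrow> K (word_embed C a) = K' (word_embed C a)"
    and A: "A \<in> Arr (word_groupoid C)"
  shows "K A = K' A"
proof -
  interpret C: small_category C by fact
  interpret H: groupoid H by fact
  interpret W: groupoid "word_groupoid C" by (rule C.groupoid_word_groupoid)
  have W: "groupoid (word_groupoid C)" by (rule C.groupoid_word_groupoid)
  note K = functorD[OF assms(3)] and K' = functorD[OF assms(4)]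
  note E = functorD[OF C.word_embed_functor]
  have main: "K (u, word_rep C u l v, v) = K' (u, word_rep C u l v, v)" if "word_path C u l v" for u l v
    using that
  proof (induction l arbitrary: u)
    case Nil
    then show ?case using eq[of v] C.word_embed_Obj[of v] C.ObjD[of v] by auto
  next
    case (Cons x l)
    obtain b a where x: "x = (b, a)" by force
    define t where "t = (if b then Src C a else Rng C a)"
    have t: "word_path C t l v" "word_path C u [(b, a)] t" "a \<in> Arr C"
      using Cons.prems by (auto simp: x t_def C.ObjI split: if_splits)
    let ?g = "(u, word_rep C u [(b, a)] t, t)"
    have g: "?g = (if b then word_embed C a else ginverse (word_groupoid C) (word_embed C a))"
    proof (cases b)
      case True
      then show ?thesis using t by (auto simp: word_embed_def t_def)
    next
      case False
      have u: "u = Src C a" "t = Rng C a" using t False by (auto simp: t_def)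
      have p: "word_path C (Src C a) [(False, a)] (Rng C a)" using t by (simp add: C.ObjI)
      have "word_rep C (Src C a) [(False, a), (True, a)] (Src C a) = word_rep C (Src C a) [] (Src C a)"
        using word_equiv.left_inverse[OF t(3)] C.word_rep_eq_iff C.word_equiv_path by blast
      then have "?g = ginverse (word_groupoid C) (word_embed C a)"
        using False C.word_rep_append[OF p C.word_path_single[OF t(3)]]
        by (intro W.ginverse_unique)
          (simp_all add: u word_embed_def C.word_groupoid_simps C.word_path_single[OF t(3)] p
             del: word_path.simps)
      then show ?thesis using False by simp
    qed
    have Kg: "K ?g = K' ?g"
      unfolding g using t(3) eq E(1)[OF t(3)]
      by (simp add: functor_ginverse[OF W assms(2,3)] functor_ginverse[OF W assms(2,4)])
    have c: "(u, word_rep C u (x # l) v, v) = Cmp (word_groupoid C) ?g (t, word_rep C t l v, v)"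
      using C.word_rep_append[OF t(2,1)] by (simp add: C.word_groupoid_simps x)
    have s: "Src (word_groupoid C) ?g = Rng (word_groupoid C) (t, word_rep C t l v, v)"
      by (simp add: C.word_groupoid_simps)
    show ?case unfolding c
      using K(4)[OF C.word_groupoid_simps(1)[OF t(2)] C.word_groupoid_simps(1)[OF t(1)] s]
        K'(4)[OF C.word_groupoid_simps(1)[OF t(2)] C.word_groupoid_simps(1)[OF t(1)] s]
        Kg Cons.IH[OF t(1)] by simp
  qed
  from A main show ?thesis by (metis C.word_groupoid_Arr)
qed

lemma ex1_extensional:
  assumes C: "small_category C"
    and ex: "\<exists>K. is_functor C H K \<and> (\<forall>a \<in> A. K (i a) = F a)"
    and sub: "i ` A \<subseteq> Arr C"
    and un: "\<And>K K' b. is_functor C H K \<Longrightarrow> is_functor C H K' \<Longrightarrow> \<forall>a \<in> A. K (i a) = F a \<Longrightarrow>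
      \<forall>a \<in> A. K' (i a) = F a \<Longrightarrow> b \<in> Arr C \<Longrightarrow> K b = K' b"
  shows "\<exists>!K. K \<in> extensional (Arr C) \<and> is_functor C H K \<and> (\<forall>a \<in> A. K (i a) = F a)"
proof (rule ex_ex1I)
  from ex obtain K where K: "is_functor C H K" "\<forall>a \<in> A. K (i a) = F a" by blast
  have "is_functor C H (restrict K (Arr C))"
    using functor_cong[OF C, of "restrict K (Arr C)" K H] K(1) by simp
  then show "\<exists>K. K \<in> extensional (Arr C) \<and> is_functor C H K \<and> (\<forall>a \<in> A. K (i a) = F a)"
    using K(2) sub by (intro exI[of _ "restrict K (Arr C)"]) auto
qed (blast intro: extensionalityI un)

theorem fundamental_groupoid_exists:
  fixes \<Lambda> :: "('a, 'b) category_scheme"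
  assumes "small_category \<Lambda>"
  shows "fundamental_groupoid \<Lambda> (word_groupoid \<Lambda>) (word_embed \<Lambda>)"
proof -
  interpret small_category \<Lambda> by fact
  interpret W: groupoid "word_groupoid \<Lambda>" by (rule groupoid_word_groupoid)
  show ?thesis
    unfolding fundamental_groupoid_def
  proof (intro conjI allI impI ex1_extensional[OF W.small_category_axioms])
    fix \<H> :: "('a \<times> 'a signed_word \<times> 'a + 'a signed_word) category" and F K K' b
    assume H: "groupoid \<H> \<and> is_functor \<Lambda> \<H> F"
    show "\<exists>K. is_functor (word_groupoid \<Lambda>) \<H> K \<and> (\<forall>a\<in>Arr \<Lambda>. K (word_embed \<Lambda> a) = F a)"
      by (rule word_groupoid_factor[OF assms conjunct1[OF H] conjunct2[OF H]])
    assume K: "is_functor (word_groupoid \<Lambda>) \<H> K" "is_functor (word_groupoid \<Lambda>) \<H> K'"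
      "\<forall>a\<in>Arr \<Lambda>. K (word_embed \<Lambda> a) = F a" "\<forall>a\<in>Arr \<Lambda>. K' (word_embed \<Lambda> a) = F a"
      "b \<in> Arr (word_groupoid \<Lambda>)"
    show "K b = K' b"
      by (rule word_groupoid_unique[OF assms conjunct1[OF H] K(1,2) _ K(5)]) (simp add: K(3,4))
  qed (use groupoid_word_groupoid word_embed_functor word_embed_bij
        functorD(1)[OF word_embed_functor] in auto)
qed

theorem fundamental_groupoid_any_type:
  fixes \<Lambda> :: "('a, 'b) category_scheme" and \<G> :: "('g, 'c) category_scheme"
    and \<H> :: "('h, 'd) category_scheme"
  assumes \<Lambda>: "small_category \<Lambda>" and fg: "fundamental_groupoid \<Lambda> \<G> i"
    and \<H>: "groupoid \<H>" and F: "is_functor \<Lambda> \<H> F"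
  shows "\<exists>!K. K \<in> extensional (Arr \<G>) \<and> is_functor \<G> \<H> K \<and> (\<forall>\<alpha> \<in> Arr \<Lambda>. K (i \<alpha>) = F \<alpha>)"
proof -
  interpret \<Lambda>: small_category \<Lambda> by fact
  let ?W = "word_groupoid \<Lambda>" and ?j = "word_embed \<Lambda>"
  interpret W: groupoid ?W by (rule \<Lambda>.groupoid_word_groupoid)
  have W: "groupoid ?W" "small_category ?W" by unfold_locales
  have G: "groupoid \<G>" "is_functor \<Lambda> \<G> i" and un:
    "\<And>(\<H> :: ('g + 'a signed_word) category) F. groupoid \<H> \<Longrightarrow> is_functor \<Lambda> \<H> F \<Longrightarrow>
        (\<exists>!K. K \<in> extensional (Arr \<G>) \<and> is_functor \<G> \<H> K \<and> (\<forall>\<alpha> \<in> Arr \<Lambda>. K (i \<alpha>) = F \<alpha>))"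
    using fg unfolding fundamental_groupoid_def by blast+
  interpret G: groupoid \<G> by (rule G(1))
  have Gc: "small_category \<G>" by unfold_locales
  have iA: "i ` Arr \<Lambda> \<subseteq> Arr \<G>" using functorD(1)[OF G(2)] by blast
  have un': "K g = K' g" if "groupoid H" "is_functor \<G> H K" "is_functor \<G> H K'"
    "\<And>a. a \<in> Arr \<Lambda> \<Longrightarrow> K (i a) = K' (i a)" "g \<in> Arr \<G>"
    for H :: "('g + 'a signed_word) category" and K K' g
  proof -
    have "is_functor \<Lambda> H (K \<circ> i)" using functor_comp[OF G(2) that(2)] .
    from un[OF that(1) this] obtain M where
      M: "\<And>L. L \<in> extensional (Arr \<G>) \<and> is_functor \<G> H L \<and> (\<forall>\<alpha> \<in> Arr \<Lambda>. L (i \<alpha>) = (K \<circ> i) \<alpha>) \<Longrightarrow> L = M"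
      by blast
    have "restrict K (Arr \<G>) = M" using that(2) functor_cong[OF Gc, of "restrict K (Arr \<G>)" K H] iA
      by (intro M) auto
    moreover have "restrict K' (Arr \<G>) = M"
      using that functor_cong[OF Gc, of "restrict K' (Arr \<G>)" K' H] iA
      by (intro M) auto
    ultimately show ?thesis using that(5) by (metis restrict_apply')
  qed
  \<comment> \<open>a functor from \<open>\<G>\<close> to the groupoid of words\<close>
  define f :: "'a \<times> 'a signed_word \<times> 'a \<Rightarrow> 'g + 'a signed_word"
    where "f = (\<lambda>(u, l, v). Inr ((True, u) # (True, v) # l))"
  have f: "inj_on f (Arr ?W)" by (auto simp: inj_on_def f_def)
  have "is_functor \<Lambda> (image_category f ?W) (f \<circ> ?j)"
    by (rule functor_comp[OF \<Lambda>.word_embed_functor functor_image(1)[OF W(2) f]])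
  from un[OF groupoid_image[OF W(1) f] this] obtain K0 where
    K0: "is_functor \<G> (image_category f ?W) K0" "\<forall>a \<in> Arr \<Lambda>. K0 (i a) = f (?j a)" by auto
  define K where "K = inv_into (Arr ?W) f \<circ> K0"
  have K: "is_functor \<G> ?W K" unfolding K_def
    by (rule functor_comp[OF K0(1) functor_image(2)[OF W(2) f]])
  have Ki: "K (i a) = ?j a" if "a \<in> Arr \<Lambda>" for a
    using that K0(2) inv_into_f_f[OF f] functorD(1)[OF \<Lambda>.word_embed_functor] by (simp add: K_def)
  \<comment> \<open>its inverse\<close>
  obtain L where L: "is_functor ?W \<G> L" "\<forall>a \<in> Arr \<Lambda>. L (?j a) = i a"
    using word_groupoid_factor[OF \<Lambda> G] by blast
  have LK: "L (K g) = g" if "g \<in> Arr \<G>" for g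
  proof -
    have h: "inj_on (Inl :: 'g \<Rightarrow> 'g + 'a signed_word) (Arr \<G>)" by simp
    note I = functor_image[OF Gc h]
    have "(Inl \<circ> (L \<circ> K)) g = (Inl :: 'g \<Rightarrow> 'g + 'a signed_word) g"
      by (rule un'[OF groupoid_image[OF G(1) h] functor_comp[OF functor_comp[OF K L(1)] I(1)] I(1)])
        (use that Ki L(2) in auto)
    then show ?thesis by simp
  qed
  obtain M where M: "is_functor ?W \<H> M" "\<forall>a \<in> Arr \<Lambda>. M (?j a) = F a"
    using word_groupoid_factor[OF \<Lambda> \<H> F] by blast
  show ?thesis
  proof (rule ex1_extensional[OF Gc _ iA])
    show "\<exists>K. is_functor \<G> \<H> K \<and> (\<forall>a\<in>Arr \<Lambda>. K (i a) = F a)"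
      using functor_comp[OF K M(1)] Ki M(2) by (intro exI[of _ "M \<circ> K"]) auto
  next
    fix N N' g assume N: "is_functor \<G> \<H> N" "is_functor \<G> \<H> N'" "\<forall>a\<in>Arr \<Lambda>. N (i a) = F a"
      "\<forall>a\<in>Arr \<Lambda>. N' (i a) = F a" "g \<in> Arr \<G>"
    have "(N \<circ> L) (K g) = (N' \<circ> L) (K g)"
      by (rule word_groupoid_unique[OF \<Lambda> \<H> functor_comp[OF L(1) N(1)] functor_comp[OF L(1) N(2)]])
        (use N L(2) functorD(1)[OF K] in auto)
    then show "N g = N' g" using LK N(5) by simp
  qed
qed


subsection \<open>Coverings\<close>

definition image_kgraph :: "('a \<Rightarrow> 'b) \<Rightarrow> ('a, 'c) kgraph_scheme \<Rightarrow> 'b kgraph" where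
  "image_kgraph f \<Sigma> = category.extend (image_category f \<Sigma>)
     (kgraph.fields (\<lambda>a. Deg \<Sigma> (inv_into (Arr \<Sigma>) f a)))"

lemma image_kgraph_simps:
  "Arr (image_kgraph f \<Sigma>) = Arr (image_category f \<Sigma>)"
  "Src (image_kgraph f \<Sigma>) = Src (image_category f \<Sigma>)"
  "Rng (image_kgraph f \<Sigma>) = Rng (image_category f \<Sigma>)"
  "Cmp (image_kgraph f \<Sigma>) = Cmp (image_category f \<Sigma>)"
  "Deg (image_kgraph f \<Sigma>) a = Deg \<Sigma> (inv_into (Arr \<Sigma>) f a)"
  by (simp_all add: image_kgraph_def category.defs kgraph.defs)

lemma image_kgraph_category:
  "is_functor (image_kgraph f \<Sigma>) D F = is_functor (image_category f \<Sigma>) D F"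
  "is_functor D' (image_kgraph f \<Sigma>) F' = is_functor D' (image_category f \<Sigma>) F'"
  "small_category (image_kgraph f \<Sigma>) = small_category (image_category f \<Sigma>)"
  "Obj (image_kgraph f \<Sigma>) = Obj (image_category f \<Sigma>)"
  "connected_category (image_kgraph f \<Sigma>) = connected_category (image_category f \<Sigma>)"
  by (simp_all add: image_kgraph_simps is_functor_def small_category_def Obj_def
      connected_category_def)

lemma Obj_image:
  assumes "small_category C" "inj_on f (Arr C)"
  shows "Obj (image_category f C) = f ` Obj C"
proof -
  interpret small_category C by fact
  show ?thesis
    using image_category_simps[OF assms(2)] inj_on_eq_iff[OF assms(2)] src_arr
    by (auto simp: Obj_def image_iff)
qed

lemma connected_category_iff:
  "connected_category C \<longleftrightarrow> (\<forall>E. equiv (Obj C) E \<longrightarrow>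
     (\<forall>a \<in> Arr C. Rng C a \<in> Obj C \<longrightarrow> Src C a \<in> Obj C \<longrightarrow> (Rng C a, Src C a) \<in> E) \<longrightarrow>
     (\<forall>u \<in> Obj C. \<forall>v \<in> Obj C. (u, v) \<in> E))" (is "_ \<longleftrightarrow> ?R")
proof -
  let ?S = "{(u, v) \<in> Obj C \<times> Obj C. \<exists>a \<in> Arr C. Rng C a = u \<and> Src C a = v}"
  have S: "?S \<subseteq> E \<longleftrightarrow> (\<forall>a \<in> Arr C. Rng C a \<in> Obj C \<longrightarrow> Src C a \<in> Obj C \<longrightarrow> (Rng C a, Src C a) \<in> E)" for E
    by auto
  have all: "equiv (Obj C) (Obj C \<times> Obj C)"
    by (rule equivI) (auto simp: refl_on_def sym_on_def trans_on_def)
  have "\<Inter> {E. equiv (Obj C) E \<and> ?S \<subseteq> E} \<subseteq> Obj C \<times> Obj C"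
    by (rule Inter_lower) (use all in auto)
  then have "connected_category C \<longleftrightarrow> Obj C \<times> Obj C \<subseteq> \<Inter> {E. equiv (Obj C) E \<and> ?S \<subseteq> E}"
    unfolding connected_category_def by blast
  also have "\<dots> \<longleftrightarrow> ?R" unfolding S by blast
  finally show ?thesis .
qed

lemma connected_category_image:
  assumes C: "small_category C" and f: "inj_on f (Arr C)" and conn: "connected_category C"
  shows "connected_category (image_category f C)"
  unfolding connected_category_iff Obj_image[OF C f]
proof (intro allI impI)
  interpret small_category C by fact
  fix E
  assume E: "equiv (f ` Obj C) E"
    and sub: "\<forall>a\<in>Arr (image_category f C). Rng (image_category f C) a \<in> f ` Obj C \<longrightarrow>
        Src (image_category f C) a \<in> f ` Obj C \<longrightarrow>
        (Rng (image_category f C) a, Src (image_category f C) a) \<in> E"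
  define E0 where "E0 = {(u, v) \<in> Obj C \<times> Obj C. (f u, f v) \<in> E}"
  have "equiv (Obj C) E0"
  proof (rule equivI)
    from E have R: "refl_on (f ` Obj C) E" "sym E" "trans E" by (auto elim: equivE)
    show "E0 \<subseteq> Obj C \<times> Obj C" by (auto simp: E0_def)
    show "refl_on (Obj C) E0" using refl_onD[OF R(1)] by (simp add: E0_def refl_on_def)
    show "sym E0" using symD[OF R(2)] by (simp add: E0_def sym_on_def)
    show "trans E0" using transD[OF R(3)] unfolding E0_def trans_def by blast
  qed
  moreover have "(Rng C a, Src C a) \<in> E0" if "a \<in> Arr C" for a
    using sub[rule_format, of "f a"] that by (simp add: image_category_simps[OF f] ObjI E0_def)
  ultimately have "\<forall>u \<in> Obj C. \<forall>v \<in> Obj C. (u, v) \<in> E0"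
    using conn unfolding connected_category_iff by blast
  then show "\<forall>u\<in>f ` Obj C. \<forall>v\<in>f ` Obj C. (u, v) \<in> E" by (auto simp: E0_def)
qed

lemma k_graph_image:
  assumes "k_graph k \<Sigma>" and f: "inj_on f (Arr \<Sigma>)"
  shows "k_graph k (image_kgraph f \<Sigma>)"
proof -
  interpret k_graph k \<Sigma> by fact
  let ?g = "inv_into (Arr \<Sigma>) f"
  have g: "?g (f a) = a" if "a \<in> Arr \<Sigma>" for a using inv_into_f_f[OF f that] .
  note S = image_kgraph_simps image_category_simps[OF f]
  have deg: "Deg (image_kgraph f \<Sigma>) = Deg \<Sigma> \<circ> ?g" by (simp add: fun_eq_iff image_kgraph_simps)
  interpret I: small_category "image_kgraph f \<Sigma>"
    unfolding image_kgraph_category by (rule small_category_image[OF small_category_axioms f])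
  show ?thesis
  proof
    show "is_functor (image_kgraph f \<Sigma>)
        (monoid_category \<lparr>carrier = Nat_tuples k, mult = (+), one = 0\<rparr>) (Deg (image_kgraph f \<Sigma>))"
      unfolding deg image_kgraph_category
      by (rule functor_comp[OF functor_image(2)[OF small_category_axioms f] degree_functor])
  next
    fix \<alpha> n l
    assume "\<alpha> \<in> Arr (image_kgraph f \<Sigma>)" and n: "n \<in> Nat_tuples k" "l \<in> Nat_tuples k"
      and d: "Deg (image_kgraph f \<Sigma>) \<alpha> = n + l"
    then obtain a where a: "a \<in> Arr \<Sigma>" "\<alpha> = f a" by (auto simp: S)
    from d have "Deg \<Sigma> a = n + l" by (simp add: a S g)
    define Q where "Q = (\<lambda>(\<beta>, \<gamma>). \<beta> \<in> Arr \<Sigma> \<and> \<gamma> \<in> Arr \<Sigma> \<and> Src \<Sigma> \<beta> = Rng \<Sigma> \<gamma> \<and> Deg \<Sigma> \<beta> = n \<and>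
        Deg \<Sigma> \<gamma> = l \<and> a = Cmp \<Sigma> \<beta> \<gamma>)"
    have "\<exists>!z. Q z"
      unfolding Q_def using factorization[OF a(1) n \<open>Deg \<Sigma> a = n + l\<close>] .
    then obtain z where z: "Q z" and uz: "\<forall>y. Q y \<longrightarrow> y = z" by (rule ex1E)
    obtain b c where zbc: "z = (b, c)" by force
    note bc = z[unfolded zbc Q_def prod.case]
    have un: "b' = b \<and> c' = c" if "b' \<in> Arr \<Sigma>" "c' \<in> Arr \<Sigma>" "Src \<Sigma> b' = Rng \<Sigma> c'" "Deg \<Sigma> b' = n"
         "Deg \<Sigma> c' = l" "a = Cmp \<Sigma> b' c'" for b' c'
      using spec[OF uz, of "(b', c')"] that by (simp add: zbc Q_def)
    show "\<exists>!(\<beta>, \<gamma>). \<beta> \<in> Arr (image_kgraph f \<Sigma>) \<and> \<gamma> \<in> Arr (image_kgraph f \<Sigma>) \<and>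
         Src (image_kgraph f \<Sigma>) \<beta> = Rng (image_kgraph f \<Sigma>) \<gamma> \<and>
         Deg (image_kgraph f \<Sigma>) \<beta> = n \<and> Deg (image_kgraph f \<Sigma>) \<gamma> = l \<and>
         \<alpha> = Cmp (image_kgraph f \<Sigma>) \<beta> \<gamma>" (is "\<exists>!x. ?P x")
    proof (rule ex1I[of ?P "(f b, f c)"])
      show "?P (f b, f c)" using bc by (simp add: S a g)
    next
      fix x assume x: "?P x"
      then obtain b' c' where x': "x = (f b', f c')" "b' \<in> Arr \<Sigma>" "c' \<in> Arr \<Sigma>"
        by (cases x) (auto simp: S)
      have "b' = b \<and> c' = c"
        using x x'(2,3) a by (intro un)
          (auto simp: x'(1) S g inj_on_eq_iff[OF f] src_arr rng_arr cmp_arr)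
      then show "x = (f b, f c)" by (simp add: x')
    qed
  qed
qed

lemma connected_covering_image:
  assumes cov: "connected_covering k \<Lambda> \<Sigma> q" and f: "inj_on f (Arr \<Sigma>)"
  shows "connected_covering k \<Lambda> (image_kgraph f \<Sigma>) (q \<circ> inv_into (Arr \<Sigma>) f)"
    and "kgraph_morphism (image_kgraph f \<Sigma>) \<Sigma> (inv_into (Arr \<Sigma>) f)"
proof -
  from cov have k: "k_graph k \<Sigma>" and conn: "connected_category \<Sigma>" and q: "kgraph_morphism \<Sigma> \<Lambda> q"
    "q ` Arr \<Sigma> = Arr \<Lambda>" and bij: "\<And>v. v \<in> Obj \<Sigma> \<Longrightarrow>
       bij_betw q {\<omega> \<in> Arr \<Sigma>. Src \<Sigma> \<omega> = v} {\<alpha> \<in> Arr \<Lambda>. Src \<Lambda> \<alpha> = q v}"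
       "\<And>v. v \<in> Obj \<Sigma> \<Longrightarrow>
       bij_betw q {\<omega> \<in> Arr \<Sigma>. Rng \<Sigma> \<omega> = v} {\<alpha> \<in> Arr \<Lambda>. Rng \<Lambda> \<alpha> = q v}"
    by (auto simp: connected_covering_def covering_def)
  interpret k_graph k \<Sigma> by fact
  let ?g = "inv_into (Arr \<Sigma>) f" and ?I = "image_kgraph f \<Sigma>"
  have g: "?g (f a) = a" if "a \<in> Arr \<Sigma>" for a using inv_into_f_f[OF f that] .
  note S = image_kgraph_simps image_category_simps[OF f]
  show m: "kgraph_morphism ?I \<Sigma> ?g"
    using functor_image(2)[OF small_category_axioms f]
    by (simp add: kgraph_morphism_def image_kgraph_category image_kgraph_simps(5))
  have qm: "kgraph_morphism ?I \<Lambda> (q \<circ> ?g)"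
    using m q(1) functor_comp functorD(1) unfolding kgraph_morphism_def by fastforce
  have im: "(q \<circ> ?g) ` Arr ?I = Arr \<Lambda>" using q(2) g by (force simp: S image_iff)
  have "bij_betw (q \<circ> ?g) {\<omega> \<in> Arr ?I. Src ?I \<omega> = v} {\<alpha> \<in> Arr \<Lambda>. Src \<Lambda> \<alpha> = (q \<circ> ?g) v} \<and>
     bij_betw (q \<circ> ?g) {\<omega> \<in> Arr ?I. Rng ?I \<omega> = v} {\<alpha> \<in> Arr \<Lambda>. Rng \<Lambda> \<alpha> = (q \<circ> ?g) v}"
    if "v \<in> Obj ?I" for v
  proof -
    from that obtain u where u: "u \<in> Obj \<Sigma>" "v = f u"
      by (auto simp: image_kgraph_category Obj_image[OF small_category_axioms f])
    have uA: "u \<in> Arr \<Sigma>" using ObjD[OF u(1)] by simp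
    have inj: "inj_on ?g (f ` X)" if "X \<subseteq> Arr \<Sigma>" for X
      using that by (auto simp: inj_on_def g subset_iff)
    have 1: "{\<omega> \<in> Arr ?I. Src ?I \<omega> = v} = f ` {\<omega> \<in> Arr \<Sigma>. Src \<Sigma> \<omega> = u}"
      "{\<omega> \<in> Arr ?I. Rng ?I \<omega> = v} = f ` {\<omega> \<in> Arr \<Sigma>. Rng \<Sigma> \<omega> = u}"
      using uA by (auto simp: S u inj_on_eq_iff[OF f] src_arr rng_arr)
    have "?g ` f ` X = X" if "X \<subseteq> Arr \<Sigma>" for X using that g by (force simp: image_iff)
    then have 2: "bij_betw ?g (f ` X) X" if "X \<subseteq> Arr \<Sigma>" for X
      using that inj by (simp add: bij_betw_def)
    show ?thesis
      unfolding 1 using bij[OF u(1)] by (auto intro!: bij_betw_trans[OF 2] simp: u(2) g[OF uA])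
  qed
  then show "connected_covering k \<Lambda> ?I (q \<circ> ?g)"
    unfolding connected_covering_def covering_def
    using k_graph_image[OF k f] qm im connected_category_image[OF small_category_axioms f conn]
    by (simp add: image_kgraph_category)
qed

lemma word_path_lift_unique:
  assumes "\<And>a b. a \<in> Arr \<Sigma> \<Longrightarrow> b \<in> Arr \<Sigma> \<Longrightarrow> Src \<Sigma> a = Src \<Sigma> b \<Longrightarrow> q a = q b \<Longrightarrow> a = b"
    and "\<And>a b. a \<in> Arr \<Sigma> \<Longrightarrow> b \<in> Arr \<Sigma> \<Longrightarrow> Rng \<Sigma> a = Rng \<Sigma> b \<Longrightarrow> q a = q b \<Longrightarrow> a = b"
  shows "word_path \<Sigma> w l v \<Longrightarrow> word_path \<Sigma> w m v' \<Longrightarrow>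
    map (map_prod id q) l = map (map_prod id q) m \<Longrightarrow> l = m"
proof (induction l arbitrary: m w)
  case (Cons x l)
  obtain y m' where m: "m = y # m'" using Cons.prems(3) by (cases m) auto
  have "fst x = fst y" "q (snd x) = q (snd y)" using Cons.prems(3)
    by (cases x; cases y; simp add: m)+
  moreover from this have "snd x = snd y" using Cons.prems(1,2) assms
    by (auto simp: m split: if_splits)
  ultimately have xy: "x = y" by (simp add: prod_eq_iff)
  have "l = m'" using Cons.prems by (auto simp: m xy split: if_splits intro: Cons.IH)
  then show ?case by (simp add: m xy)
qed auto

lemma connected_covering_inj:
  fixes q :: "'c \<Rightarrow> 'a"
  assumes "connected_covering k \<Lambda> \<Sigma> q"
  shows "\<exists>f :: 'c \<Rightarrow> 'a signed_word. inj_on f (Arr \<Sigma>)"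
proof (cases "Arr \<Sigma> = {}")
  case False
  from assms have k: "k_graph k \<Sigma>" and conn: "connected_category \<Sigma>" and bij: "\<And>v. v \<in> Obj \<Sigma> \<Longrightarrow>
       inj_on q {\<omega> \<in> Arr \<Sigma>. Src \<Sigma> \<omega> = v}" "\<And>v. v \<in> Obj \<Sigma> \<Longrightarrow> inj_on q {\<omega> \<in> Arr \<Sigma>. Rng \<Sigma> \<omega> = v}"
    by (auto simp: connected_covering_def covering_def bij_betw_def)
  interpret k_graph k \<Sigma> by fact
  from False obtain w where w: "w \<in> Obj \<Sigma>" using ObjI by blast
  define E where "E = {(u, v). \<exists>l. word_path \<Sigma> u l v}"
  have refl: "refl_on (Obj \<Sigma>) E"
    unfolding E_def refl_on_def by (auto intro!: exI[of _ "[]"])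
  have E: "equiv (Obj \<Sigma>) E"
  proof (rule equivI[OF _ refl])
    show "E \<subseteq> Obj \<Sigma> \<times> Obj \<Sigma>" using word_path_Obj by (auto simp: E_def)
    show "sym E" using word_path_inverse unfolding E_def sym_def by blast
    show "trans E" using word_path_append unfolding E_def trans_def by blast
  qed
  have "(Rng \<Sigma> a, Src \<Sigma> a) \<in> E" if "a \<in> Arr \<Sigma>" for a
    unfolding E_def using word_path_single[OF that] by blast
  with E have "\<forall>v \<in> Obj \<Sigma>. \<exists>l. word_path \<Sigma> w l v"
    using conn w unfolding connected_category_iff E_def by blast
  then obtain l where l: "\<And>v. v \<in> Obj \<Sigma> \<Longrightarrow> word_path \<Sigma> w (l v) v" by metis
  define h where "h a = l (Src \<Sigma> a) @ [(False, a)]" for a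
  have h: "word_path \<Sigma> w (h a) (Rng \<Sigma> a)" if "a \<in> Arr \<Sigma>" for a
    unfolding h_def using that by (intro word_path_append[OF l]) (auto simp: ObjI)
  have "inj_on (\<lambda>a. map (map_prod id q) (h a)) (Arr \<Sigma>)"
  proof (rule inj_onI)
    fix a b assume a: "a \<in> Arr \<Sigma>" and b: "b \<in> Arr \<Sigma>"
      and eq: "map (map_prod id q) (h a) = map (map_prod id q) (h b)"
    have "h a = h b"
    proof (rule word_path_lift_unique[OF _ _ h[OF a] h[OF b] eq])
      fix c d assume cd: "c \<in> Arr \<Sigma>" "d \<in> Arr \<Sigma>" "q c = q d"
      show "c = d" if "Src \<Sigma> c = Src \<Sigma> d"
        by (rule inj_onD[OF bij(1)[OF ObjI(1)[OF cd(1)]] cd(3)]) (use cd that in auto)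
      show "c = d" if "Rng \<Sigma> c = Rng \<Sigma> d"
        by (rule inj_onD[OF bij(2)[OF ObjI(2)[OF cd(1)]] cd(3)]) (use cd that in auto)
    qed
    then show "a = b" by (simp add: h_def)
  qed
  then show ?thesis by blast
qed simp

theorem universal_covering_any_type:
  fixes \<Lambda> :: "('a, 'b) kgraph_scheme" and \<Sigma> :: "('c, 'd) kgraph_scheme"
  assumes "universal_covering k \<Lambda> \<Omega> p" and \<Sigma>: "connected_covering k \<Lambda> \<Sigma> q"
  shows "\<exists>\<phi>. covering_morphism \<Omega> p \<Sigma> q \<phi>"
proof -
  obtain f :: "'c \<Rightarrow> 'a signed_word" where f: "inj_on f (Arr \<Sigma>)"
    using connected_covering_inj[OF \<Sigma>] by blast
  note I = connected_covering_image[OF \<Sigma> f]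
  from assms(1) I(1) obtain \<phi> where
    "covering_morphism \<Omega> p (image_kgraph f \<Sigma>) (q \<circ> inv_into (Arr \<Sigma>) f) \<phi>"
    unfolding universal_covering_def by blast
  then have \<phi>: "is_functor \<Omega> (image_kgraph f \<Sigma>) \<phi>"
    "\<And>\<omega>. \<omega> \<in> Arr \<Omega> \<Longrightarrow> Deg (image_kgraph f \<Sigma>) (\<phi> \<omega>) = Deg \<Omega> \<omega>"
    "\<And>\<omega>. \<omega> \<in> Arr \<Omega> \<Longrightarrow> q (inv_into (Arr \<Sigma>) f (\<phi> \<omega>)) = p \<omega>"
    by (simp_all add: covering_morphism_def kgraph_morphism_def)
  from I(2) have g: "is_functor (image_kgraph f \<Sigma>) \<Sigma> (inv_into (Arr \<Sigma>) f)"
    by (simp add: kgraph_morphism_def)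
  have "covering_morphism \<Omega> p \<Sigma> q (inv_into (Arr \<Sigma>) f \<circ> \<phi>)"
    unfolding covering_morphism_def kgraph_morphism_def
    using functor_comp[OF \<phi>(1) g] \<phi>(2,3) by (simp add: image_kgraph_simps(5))
  then show ?thesis by blast
qed

end

theory Submission
  imports Defs
begin

text \<open>Choose an arrow \<open>\<gamma> y\<close> of the fundamental groupoid from the base point to each object \<open>y\<close>, and let
  \<open>\<eta> \<alpha>\<close> be the loop \<open>\<gamma>(r(\<alpha>))\<inverse> i(\<alpha>) \<gamma>(s(\<alpha>))\<close>. The skew product is connected because the
  image of \<open>\<Lambda>\<close> generates the fundamental groupoid: the set of arrows whose lifts join equivalent
  vertices is a subgroupoid containing that image. It is universal because, for any covering, unique
  lifting lets the fundamental groupoid act on the fibres; after choosing a vertex \<open>w\<close> over the base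
  point, \<open>(\<alpha>, g)\<close> is sent to the lift of \<open>\<alpha>\<close> with source \<open>\<gamma>(s(\<alpha>)) g \<cdot> w\<close>.\<close>

section \<open>Groupoids and their vertex groups\<close>

context groupoid
begin

lemma ginverse_cancel:
  assumes "a \<in> Arr C" "b \<in> Arr C"
  shows "Rng C b = Rng C a \<Longrightarrow> Cmp C a (Cmp C (ginverse C a) b) = b"
    and "Rng C b = Src C a \<Longrightarrow> Cmp C (ginverse C a) (Cmp C a b) = b"
  using assms cmp_assoc[of a "ginverse C a" b] cmp_assoc[of "ginverse C a" a b] cmp_rng[of b]
  by (simp_all add: ginverse)

lemma group_vertex_group:
  assumes x: "x \<in> Obj C"
  shows "group (vertex_group C x)"
proof (rule groupI)
  fix a assume "a \<in> carrier (vertex_group C x)"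
  then show "\<exists>b \<in> carrier (vertex_group C x). b \<otimes>\<^bsub>vertex_group C x\<^esub> a = \<one>\<^bsub>vertex_group C x\<^esub>"
    by (intro bexI[of _ "ginverse C a"]) (auto simp: vertex_group_def ginverse)
qed (use ObjD[OF x] cmp_rng in \<open>auto simp: vertex_group_def cmp_arr src_cmp rng_cmp cmp_assoc\<close>)

text \<open>Conjugating by a chosen arrow from \<open>x\<close> to each object retracts a connected groupoid onto its
  vertex group at \<open>x\<close>.\<close>

definition retract_arr :: "('a \<Rightarrow> 'a) \<Rightarrow> 'a \<Rightarrow> 'a" where
  "retract_arr \<gamma> a = Cmp C (ginverse C (\<gamma> (Rng C a))) (Cmp C a (\<gamma> (Src C a)))"

context
  fixes x \<gamma>
  assumes \<gamma>: "\<forall>y \<in> Obj C. \<gamma> y \<in> Arr C \<and> Rng C (\<gamma> y) = y \<and> Src C (\<gamma> y) = x"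
begin

text \<open>In the product of the loops of \<open>a\<close> and \<open>b\<close>, the inner factors
  \<gamma>(s(a)) and \<gamma>(r(b))\<inverse> belong to the same object and cancel. On an identity,
  the two outer factors cancel.\<close>

lemma retract_arr_functor: "is_functor C (monoid_category (vertex_group C x)) (retract_arr \<gamma>)"
proof -
  have \<gamma>': "\<gamma> (Src C a) \<in> Arr C" "\<gamma> (Rng C a) \<in> Arr C" "Rng C (\<gamma> (Src C a)) = Src C a"
    "Rng C (\<gamma> (Rng C a)) = Rng C a" "Src C (\<gamma> (Src C a)) = x" "Src C (\<gamma> (Rng C a)) = x"
    if "a \<in> Arr C" for a
    using \<gamma> ObjI[OF that] by auto
  note S = retract_arr_def monoid_category_def vertex_group_def \<gamma>' ginverse cmp_arr src_cmp rng_cmp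
    src_src src_rng rng_src rng_rng src_arr rng_arr
  have 1: "Cmp C (Src C a) (\<gamma> (Src C a)) = \<gamma> (Src C a)" "Cmp C (Rng C a) (\<gamma> (Rng C a)) = \<gamma> (Rng C a)"
    if "a \<in> Arr C" for a
    using cmp_rng[of "\<gamma> (Src C a)"] cmp_rng[of "\<gamma> (Rng C a)"] that by (simp_all add: \<gamma>')
  show ?thesis
    unfolding is_functor_def
  proof (intro conjI ballI impI)
    fix a b assume ab: "a \<in> Arr C" "b \<in> Arr C" "Src C a = Rng C b"
    have g: "\<gamma> (Rng C b) \<in> Arr C" "Rng C (\<gamma> (Rng C b)) = Rng C b" "Src C (\<gamma> (Rng C b)) = x"
      using ab \<gamma>' by auto
    show "retract_arr \<gamma> (Cmp C a b) =
        Cmp (monoid_category (vertex_group C x)) (retract_arr \<gamma> a) (retract_arr \<gamma> b)"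
      using ab by (simp add: S cmp_assoc ginverse_cancel)
  qed (simp_all add: S 1)
qed

text \<open>Solving \<gamma>(u)\<inverse> a \<gamma>(v) = g for a gives a = \<gamma>(u) g
  \<gamma>(v)\<inverse>. Connectedness of the skew product needs both ends of the arrow prescribed
  together with its value.\<close>

lemma retract_arr_surj:
  assumes "u \<in> Obj C" "v \<in> Obj C" "g \<in> carrier (vertex_group C x)"
  obtains a where "a \<in> Arr C" "Rng C a = u" "Src C a = v" "retract_arr \<gamma> a = g"
proof -
  let ?a = "Cmp C (\<gamma> u) (Cmp C g (ginverse C (\<gamma> v)))"
  have g: "g \<in> Arr C" "Rng C g = x" "Src C g = x" using assms(3) by (auto simp: vertex_group_def)
  note S = bspec[OF \<gamma> assms(1)] bspec[OF \<gamma> assms(2)] g ginverse cmp_arr src_cmp rng_cmp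
  have "retract_arr \<gamma> ?a = g"
    using cmp_src[OF g(1)] by (simp add: retract_arr_def S cmp_assoc ginverse_cancel)
  then show ?thesis by (intro that[of ?a]) (simp_all add: S)
qed

text \<open>The factor \<gamma>(r(a)) cancels the inverse in \<open>retract_arr\<close>. In the
  monodromy action this says that moving the vertex with label g over s(a) along a reaches the
  vertex over r(a) whose label is the loop of a times g.\<close>

lemma retract_arr_lift:
  assumes "a \<in> Arr C" "g \<in> carrier (vertex_group C x)"
  shows "Cmp C (\<gamma> (Rng C a)) (Cmp C (retract_arr \<gamma> a) g) = Cmp C a (Cmp C (\<gamma> (Src C a)) g)"
proof -
  have g: "g \<in> Arr C" "Rng C g = x" "Src C g = x" using assms(2) by (auto simp: vertex_group_def)
  note S = bspec[OF \<gamma> ObjI(1)[OF assms(1)]] bspec[OF \<gamma> ObjI(2)[OF assms(1)]] g ginverse cmp_arr src_cmp rng_cmp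
  show ?thesis using assms(1) by (simp add: retract_arr_def S cmp_assoc ginverse_cancel)
qed

end

end

section \<open>Generation and connectedness of the fundamental groupoid\<close>

text \<open>The arrows satisfying \<open>P\<close> form a subgroupoid \<open>S\<close> through which
  \<open>i\<close> factors. The universal property yields a functor \<open>K\<close> from \<G> to
  \<open>S\<close> fixing the image of \<open>i\<close>, and its uniqueness part forces
  \<open>K\<close> to be the identity, so every arrow lies in \<open>S\<close>.\<close>

lemma fundamental_groupoid_induct [consumes 3, case_names base comp inverse]:
  fixes \<Lambda> :: "('a, 'b) category_scheme" and \<G> :: "('g, 'c) category_scheme"
  assumes \<Lambda>: "small_category \<Lambda>" and fg: "fundamental_groupoid \<Lambda> \<G> i" and A: "A \<in> Arr \<G>"
    and base: "\<And>\<alpha>. \<alpha> \<in> Arr \<Lambda> \<Longrightarrow> P (i \<alpha>)"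
    and comp: "\<And>A B. A \<in> Arr \<G> \<Longrightarrow> B \<in> Arr \<G> \<Longrightarrow> Src \<G> A = Rng \<G> B \<Longrightarrow> P A \<Longrightarrow> P B \<Longrightarrow> P (Cmp \<G> A B)"
    and inverse: "\<And>A. A \<in> Arr \<G> \<Longrightarrow> P A \<Longrightarrow> P (ginverse \<G> A)"
  shows "P A"
proof -
  have G: "groupoid \<G>" "is_functor \<Lambda> \<G> i" using fg by (auto simp: fundamental_groupoid_def)
  interpret \<Lambda>: small_category \<Lambda> by fact
  interpret groupoid \<G> by (rule G)
  define S where "S = \<lparr>Arr = {A \<in> Arr \<G>. P A}, Src = Src \<G>, Rng = Rng \<G>, Cmp = Cmp \<G>\<rparr>"
  have S: "Arr S = {A \<in> Arr \<G>. P A}" "Src S = Src \<G>" "Rng S = Rng \<G>" "Cmp S = Cmp \<G>"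
    by (simp_all add: S_def)
  \<comment> \<open>The identities at the ends of an arrow of \<open>S\<close> are products of that
    arrow with its inverse, so they lie in \<open>S\<close> as well.\<close>
  have P: "P (Src \<G> A)" "P (Rng \<G> A)" if "A \<in> Arr \<G>" "P A" for A
    using comp[of "ginverse \<G> A" A] comp[of A "ginverse \<G> A"] inverse[of A] that
    by (simp_all add: ginverse)
  interpret S: small_category S
    by unfold_locales (auto simp: S src_arr rng_arr src_src src_rng rng_src rng_rng cmp_arr src_cmp
        rng_cmp cmp_src cmp_rng cmp_assoc P comp)
  interpret S: groupoid S
  proof
    fix A assume "A \<in> Arr S"
    then show "\<exists>B\<in>Arr S. Src S B = Rng S A \<and> Rng S B = Src S A \<and>
        Cmp S B A = Src S A \<and> Cmp S A B = Rng S A"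
      by (intro bexI[of _ "ginverse \<G> A"]) (auto simp: S ginverse inverse)
  qed
  have "is_functor \<Lambda> S i" using G(2) base by (auto simp: is_functor_def S)
  from fundamental_groupoid_any_type[OF \<Lambda> fg S.groupoid_axioms this]
  obtain K where K: "is_functor \<G> S K" "\<forall>\<alpha> \<in> Arr \<Lambda>. K (i \<alpha>) = i \<alpha>" by blast
  have iA: "\<And>\<alpha>. \<alpha> \<in> Arr \<Lambda> \<Longrightarrow> i \<alpha> \<in> Arr \<G>" using functorD(1)[OF G(2)] by blast
  \<comment> \<open>Uniqueness is applied to \<open>i\<close> as a functor into \<G> itself:
    \<open>K\<close>, read as an endofunctor of \<G>, and the identity both extend it. They are
    restricted to \<open>Arr \<G>\<close> because uniqueness holds among extensional maps.\<close>
  from fundamental_groupoid_any_type[OF \<Lambda> fg G] obtain M where un: "\<And>L. L \<in> extensional (Arr \<G>) \<Longrightarrow>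
      is_functor \<G> \<G> L \<Longrightarrow> \<forall>\<alpha> \<in> Arr \<Lambda>. L (i \<alpha>) = i \<alpha> \<Longrightarrow> L = M" by blast
  have "is_functor \<G> \<G> K" using K(1) by (auto simp: is_functor_def S)
  then have "is_functor \<G> \<G> (restrict K (Arr \<G>))"
    using functor_cong[OF small_category_axioms, of "restrict K (Arr \<G>)" K \<G>] by simp
  moreover have "is_functor \<G> \<G> (\<lambda>A. A)" by (simp add: is_functor_def)
  then have "is_functor \<G> \<G> (restrict (\<lambda>A. A) (Arr \<G>))"
    using functor_cong[OF small_category_axioms, of "restrict (\<lambda>A. A) (Arr \<G>)" "\<lambda>A. A" \<G>] by simp
  ultimately have "restrict K (Arr \<G>) = restrict (\<lambda>A. A) (Arr \<G>)"
    using un[of "restrict K (Arr \<G>)"] un[of "restrict (\<lambda>A. A) (Arr \<G>)"] K(2) iA by auto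
  then have "K A = A" using A by (metis restrict_apply')
  then show ?thesis using functorD(1)[OF K(1) A] by (simp add: S)
qed

text \<open>Identities, inverses and composites in \<G> make being joined by an arrow of \<G> an
  equivalence relation on the objects of \<Lambda>. It contains the pairs that generate the full
  relation, so it is full.\<close>

lemma fundamental_groupoid_connected:
  assumes \<Lambda>: "small_category \<Lambda>" and conn: "connected_category \<Lambda>" and fg: "fundamental_groupoid \<Lambda> \<G> i"
    and "u \<in> Obj \<G>" "v \<in> Obj \<G>"
  obtains A where "A \<in> Arr \<G>" "Rng \<G> A = u" "Src \<G> A = v"
proof -
  have G: "groupoid \<G>" "is_functor \<Lambda> \<G> i" "bij_betw i (Obj \<Lambda>) (Obj \<G>)"
    using fg by (auto simp: fundamental_groupoid_def)
  interpret \<Lambda>: small_category \<Lambda> by fact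
  interpret groupoid \<G> by (rule G)
  obtain u' v' where uv: "u' \<in> Obj \<Lambda>" "u = i u'" "v' \<in> Obj \<Lambda>" "v = i v'"
    using assms(4,5) G(3) by (metis bij_betw_imp_surj_on imageE)
  define E where "E = {(u, v) \<in> Obj \<Lambda> \<times> Obj \<Lambda>. \<exists>A \<in> Arr \<G>. Rng \<G> A = i u \<and> Src \<G> A = i v}"
  have i: "i w \<in> Arr \<G>" "Src \<G> (i w) = i w" "Rng \<G> (i w) = i w" if "w \<in> Obj \<Lambda>" for w
    using that G(3) ObjD[of "i w"] by (auto simp: bij_betw_def)
  have "equiv (Obj \<Lambda>) E"
  proof (rule equivI)
    show "E \<subseteq> Obj \<Lambda> \<times> Obj \<Lambda>" by (auto simp: E_def)
    show "refl_on (Obj \<Lambda>) E" using i by (auto simp: E_def refl_on_def)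
    show "sym E" using ginverse(1,2,3) unfolding E_def sym_def by auto metis
    show "trans E" using cmp_arr src_cmp rng_cmp unfolding E_def trans_def by auto metis
  qed
  moreover have "(Rng \<Lambda> a, Src \<Lambda> a) \<in> E" if "a \<in> Arr \<Lambda>" for a
    using functorD[OF G(2)] that \<Lambda>.ObjI by (auto simp: E_def intro!: bexI[of _ "i a"])
  ultimately have "(u', v') \<in> E" using conn uv unfolding connected_category_iff by blast
  then show thesis using that uv by (auto simp: E_def)
qed


section \<open>Skew products\<close>

lemma skew_product_simps:
  "Arr (skew_product \<Lambda> G \<eta>) = Arr \<Lambda> \<times> carrier G"
  "Src (skew_product \<Lambda> G \<eta>) (\<alpha>, g) = (Src \<Lambda> \<alpha>, g)"
  "Rng (skew_product \<Lambda> G \<eta>) (\<alpha>, g) = (Rng \<Lambda> \<alpha>, \<eta> \<alpha> \<otimes>\<^bsub>G\<^esub> g)"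
  "Cmp (skew_product \<Lambda> G \<eta>) (\<alpha>, h) (\<beta>, g) = (Cmp \<Lambda> \<alpha> \<beta>, g)"
  "Deg (skew_product \<Lambda> G \<eta>) (\<alpha>, g) = Deg \<Lambda> \<alpha>"
  by (simp_all add: skew_product_def)

lemma Obj_skew_product: "Obj (skew_product \<Lambda> G \<eta>) = Obj \<Lambda> \<times> carrier G"
  by (auto simp: Obj_def skew_product_simps)

lemma cocycleD:
  assumes "cocycle \<Lambda> G \<eta>"
  shows "group G" "a \<in> Arr \<Lambda> \<Longrightarrow> \<eta> a \<in> carrier G"
    "a \<in> Arr \<Lambda> \<Longrightarrow> \<eta> (Src \<Lambda> a) = \<one>\<^bsub>G\<^esub>" "a \<in> Arr \<Lambda> \<Longrightarrow> \<eta> (Rng \<Lambda> a) = \<one>\<^bsub>G\<^esub>"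
    "a \<in> Arr \<Lambda> \<Longrightarrow> b \<in> Arr \<Lambda> \<Longrightarrow> Src \<Lambda> a = Rng \<Lambda> b \<Longrightarrow> \<eta> (Cmp \<Lambda> a b) = \<eta> a \<otimes>\<^bsub>G\<^esub> \<eta> b"
  using assms by (auto simp: cocycle_def is_functor_def monoid_category_def)

text \<open>The group components of a factorization of (\<alpha>, g) are forced: composition makes
  that of the right factor g, and composability makes that of the left factor \<eta>(\<gamma>) g.
  Existence and uniqueness thus reduce to factorization in \<Lambda>.\<close>

lemma k_graph_skew_product:
  assumes "k_graph k \<Lambda>" and \<eta>: "cocycle \<Lambda> G \<eta>"
  shows "k_graph k (skew_product \<Lambda> G \<eta>)"
proof -
  interpret k_graph k \<Lambda> by fact
  interpret G: group G by (rule cocycleD[OF \<eta>])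
  let ?S = "skew_product \<Lambda> G \<eta>"
  note S = skew_product_simps cocycleD(2-)[OF \<eta>]
  interpret S: small_category ?S
    by unfold_locales (auto simp: S src_arr rng_arr src_src src_rng rng_src rng_rng cmp_arr src_cmp
        rng_cmp cmp_src cmp_rng cmp_assoc G.m_assoc)
  show ?thesis
  proof
    show "is_functor ?S (monoid_category \<lparr>carrier = Nat_tuples k, mult = (+), one = 0\<rparr>) (Deg ?S)"
      using degree_functor by (auto simp: is_functor_def S monoid_category_def)
  next
    fix a n l
    assume a: "a \<in> Arr ?S" and n: "n \<in> Nat_tuples k" "l \<in> Nat_tuples k" and d: "Deg ?S a = n + l"
    obtain \<alpha> g where \<alpha>: "a = (\<alpha>, g)" "\<alpha> \<in> Arr \<Lambda>" "g \<in> carrier G" using a by (auto simp: S)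
    define Q where "Q = (\<lambda>(\<beta>, \<gamma>). \<beta> \<in> Arr \<Lambda> \<and> \<gamma> \<in> Arr \<Lambda> \<and> Src \<Lambda> \<beta> = Rng \<Lambda> \<gamma> \<and> Deg \<Lambda> \<beta> = n \<and>
        Deg \<Lambda> \<gamma> = l \<and> \<alpha> = Cmp \<Lambda> \<beta> \<gamma>)"
    have "\<exists>!z. Q z"
      unfolding Q_def using d by (intro factorization[OF \<alpha>(2) n]) (simp add: \<alpha> S)
    then obtain \<beta> \<gamma> where q: "Q (\<beta>, \<gamma>)" and u: "\<And>\<beta>' \<gamma>'. Q (\<beta>', \<gamma>') \<Longrightarrow> \<beta>' = \<beta> \<and> \<gamma>' = \<gamma>" by auto
    show "\<exists>!(\<beta>, \<gamma>). \<beta> \<in> Arr ?S \<and> \<gamma> \<in> Arr ?S \<and> Src ?S \<beta> = Rng ?S \<gamma> \<and> Deg ?S \<beta> = n \<and>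
        Deg ?S \<gamma> = l \<and> a = Cmp ?S \<beta> \<gamma>" (is "\<exists>!z. ?P z")
    proof (rule ex1I[of ?P "((\<beta>, \<eta> \<gamma> \<otimes>\<^bsub>G\<^esub> g), (\<gamma>, g))"])
      show "?P ((\<beta>, \<eta> \<gamma> \<otimes>\<^bsub>G\<^esub> g), (\<gamma>, g))" using q \<alpha> by (simp add: Q_def S)
    next
      fix z assume z: "?P z"
      obtain \<beta>' h \<gamma>' g' where z': "z = ((\<beta>', h), (\<gamma>', g'))" by (metis surj_pair)
      from z have "Q (\<beta>', \<gamma>')" "h = \<eta> \<gamma>' \<otimes>\<^bsub>G\<^esub> g'" "g' = g" by (auto simp: z' S \<alpha> Q_def)
      with u show "z = ((\<beta>, \<eta> \<gamma> \<otimes>\<^bsub>G\<^esub> g), (\<gamma>, g))" by (auto simp: z')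
    qed
  qed
qed

text \<open>Lifts are explicit: \<alpha> lifts to (\<alpha>, g) when the source has label g, and to
  (\<alpha>, \<eta>(\<alpha>)\<inverse> g) when the range has label g.\<close>

lemma covering_skew_product:
  assumes "k_graph k \<Lambda>" and \<eta>: "cocycle \<Lambda> G \<eta>"
  shows "covering k \<Lambda> (skew_product \<Lambda> G \<eta>) fst"
proof -
  interpret k_graph k \<Lambda> by fact
  interpret G: group G by (rule cocycleD[OF \<eta>])
  let ?S = "skew_product \<Lambda> G \<eta>"
  note S = skew_product_simps cocycleD(2-)[OF \<eta>]
  have "kgraph_morphism ?S \<Lambda> fst"
    by (auto simp: kgraph_morphism_def is_functor_def S)
  moreover have "fst ` Arr ?S = Arr \<Lambda>"
    using G.one_closed by (auto simp: S fst_image_times)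
  moreover have "bij_betw fst {\<omega> \<in> Arr ?S. Src ?S \<omega> = (u, g)} {\<alpha> \<in> Arr \<Lambda>. Src \<Lambda> \<alpha> = u}"
    if "g \<in> carrier G" for u g
    by (rule bij_betw_byWitness[of _ "\<lambda>\<alpha>. (\<alpha>, g)"]) (use that in \<open>auto simp: S\<close>)
  moreover have "bij_betw fst {\<omega> \<in> Arr ?S. Rng ?S \<omega> = (u, g)} {\<alpha> \<in> Arr \<Lambda>. Rng \<Lambda> \<alpha> = u}"
    if "g \<in> carrier G" for u g
    by (rule bij_betw_byWitness[of _ "\<lambda>\<alpha>. (\<alpha>, inv\<^bsub>G\<^esub> \<eta> \<alpha> \<otimes>\<^bsub>G\<^esub> g)"])
      (use that in \<open>auto simp: S G.m_assoc[symmetric]\<close>)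
  ultimately show ?thesis
    using k_graph_skew_product[OF assms] by (auto simp: covering_def Obj_skew_product)
qed

section \<open>Connectedness of the skew product\<close>

text \<open>Given an equivalence relation \<open>E\<close> containing the pairs of ends of
  skew-product arrows, induction over \<G> extends this from the image of \<open>i\<close> to all
  arrows of \<G>. Hypothesis \<open>surj\<close> then supplies an arrow joining any two prescribed
  vertices.\<close>

lemma connected_skew_product:
  fixes \<Lambda> :: "('a, 'b) kgraph_scheme" and \<G> :: "('g, 'c) category_scheme"
  assumes \<Lambda>: "small_category \<Lambda>" and fg: "fundamental_groupoid \<Lambda> \<G> i"
    and "group G" and t: "is_functor \<G> (monoid_category G) t"
    and surj: "\<And>u v g. u \<in> Obj \<G> \<Longrightarrow> v \<in> Obj \<G> \<Longrightarrow> g \<in> carrier G \<Longrightarrow>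
      \<exists>A \<in> Arr \<G>. Rng \<G> A = u \<and> Src \<G> A = v \<and> t A = g"
  shows "connected_category (skew_product \<Lambda> G (t \<circ> i))"
  unfolding connected_category_iff Obj_skew_product
proof (intro allI impI)
  have G: "groupoid \<G>" "is_functor \<Lambda> \<G> i" and bij: "bij_betw i (Obj \<Lambda>) (Obj \<G>)"
    using fg by (auto simp: fundamental_groupoid_def)
  interpret \<Lambda>: small_category \<Lambda> by fact
  interpret groupoid \<G> by (rule G)
  interpret G: group G by fact
  have t: "\<And>A. A \<in> Arr \<G> \<Longrightarrow> t A \<in> carrier G" "\<And>A. A \<in> Arr \<G> \<Longrightarrow> t (Rng \<G> A) = \<one>\<^bsub>G\<^esub>"
    "\<And>A B. A \<in> Arr \<G> \<Longrightarrow> B \<in> Arr \<G> \<Longrightarrow> Src \<G> A = Rng \<G> B \<Longrightarrow> t (Cmp \<G> A B) = t A \<otimes>\<^bsub>G\<^esub> t B"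
    using t by (auto simp: is_functor_def monoid_category_def)
  fix E assume E: "equiv (Obj \<Lambda> \<times> carrier G) E"
    and "\<forall>a\<in>Arr (skew_product \<Lambda> G (t \<circ> i)). Rng (skew_product \<Lambda> G (t \<circ> i)) a \<in> Obj \<Lambda> \<times> carrier G \<longrightarrow>
      Src (skew_product \<Lambda> G (t \<circ> i)) a \<in> Obj \<Lambda> \<times> carrier G \<longrightarrow>
      (Rng (skew_product \<Lambda> G (t \<circ> i)) a, Src (skew_product \<Lambda> G (t \<circ> i)) a) \<in> E"
  then have EA: "((Rng \<Lambda> \<alpha>, t (i \<alpha>) \<otimes>\<^bsub>G\<^esub> g), (Src \<Lambda> \<alpha>, g)) \<in> E" if "\<alpha> \<in> Arr \<Lambda>" "g \<in> carrier G" for \<alpha> g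
    using that \<Lambda>.ObjI functorD(1)[OF G(2)] t(1) by (simp add: skew_product_simps)
  have sym: "(b, a) \<in> E" if "(a, b) \<in> E" for a b
    using E that by (auto elim!: equivE dest: symD)
  have trans: "(a, c) \<in> E" if "(a, b) \<in> E" "(b, c) \<in> E" for a b c
    using E that by (auto elim!: equivE dest: transD)
  have inj: "u = v" if "i u = i v" "u \<in> Obj \<Lambda>" "v \<in> Obj \<Lambda>" for u v
    using bij that by (auto simp: bij_betw_def inj_on_def)
  \<comment> \<open>The claim is made for all labels g at once: the composition case uses it for
    \<open>A\<close> at the label t(B) g, and the inverse case at t(A\<inverse>) g.\<close>
  have main: "\<forall>u \<in> Obj \<Lambda>. \<forall>v \<in> Obj \<Lambda>. \<forall>g \<in> carrier G. Rng \<G> A = i u \<longrightarrow> Src \<G> A = i v \<longrightarrow>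
      ((u, t A \<otimes>\<^bsub>G\<^esub> g), (v, g)) \<in> E" if "A \<in> Arr \<G>" for A
    using \<Lambda> fg that
  proof (induction rule: fundamental_groupoid_induct)
    case (base \<alpha>)
    then show ?case
      using EA functorD(2,3)[OF G(2)] inj \<Lambda>.ObjI by metis
  next
    case (comp A B)
    show ?case
    proof (intro ballI impI)
      fix u v g assume uv: "u \<in> Obj \<Lambda>" "v \<in> Obj \<Lambda>" "g \<in> carrier G" "Rng \<G> (Cmp \<G> A B) = i u"
        "Src \<G> (Cmp \<G> A B) = i v"
      have "Rng \<G> B \<in> i ` Obj \<Lambda>" using bij ObjI comp by (simp add: bij_betw_def)
      then obtain w where w: "w \<in> Obj \<Lambda>" "Rng \<G> B = i w" by blast
      have "((w, t B \<otimes>\<^bsub>G\<^esub> g), (v, g)) \<in> E" "((u, t A \<otimes>\<^bsub>G\<^esub> (t B \<otimes>\<^bsub>G\<^esub> g)), (w, t B \<otimes>\<^bsub>G\<^esub> g)) \<in> E"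
        using comp uv w by (simp_all add: src_cmp rng_cmp t)
      from trans[OF this(2,1)] show "((u, t (Cmp \<G> A B) \<otimes>\<^bsub>G\<^esub> g), (v, g)) \<in> E"
        using comp uv by (simp add: t G.m_assoc)
    qed
  next
    case (inverse A)
    show ?case
    proof (intro ballI impI)
      fix u v g assume uv: "u \<in> Obj \<Lambda>" "v \<in> Obj \<Lambda>" "g \<in> carrier G" "Rng \<G> (ginverse \<G> A) = i u"
        "Src \<G> (ginverse \<G> A) = i v"
      have "t A \<otimes>\<^bsub>G\<^esub> (t (ginverse \<G> A) \<otimes>\<^bsub>G\<^esub> g) = g"
        using t(3)[of A "ginverse \<G> A"] inverse uv by (simp add: ginverse t G.m_assoc[symmetric])
      moreover have "t (ginverse \<G> A) \<otimes>\<^bsub>G\<^esub> g \<in> carrier G"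
        using inverse uv by (simp add: ginverse t)
      moreover have "Rng \<G> A = i v" "Src \<G> A = i u" using inverse.hyps uv by (simp_all add: ginverse)
      ultimately have "((v, g), (u, t (ginverse \<G> A) \<otimes>\<^bsub>G\<^esub> g)) \<in> E"
        using inverse.IH uv(1,2) by metis
      then show "((u, t (ginverse \<G> A) \<otimes>\<^bsub>G\<^esub> g), (v, g)) \<in> E" by (rule sym)
    qed
  qed
  have "((u, g), (v, h)) \<in> E" if *: "u \<in> Obj \<Lambda>" "v \<in> Obj \<Lambda>" "g \<in> carrier G" "h \<in> carrier G" for u v g h
  proof -
    have "i u \<in> Obj \<G>" "i v \<in> Obj \<G>" using * bij by (auto simp: bij_betw_def)
    \<comment> \<open>The value g h\<inverse> is the one that carries the label h to g.\<close>
    then obtain A where "A \<in> Arr \<G>" "Rng \<G> A = i u" "Src \<G> A = i v" "t A = g \<otimes>\<^bsub>G\<^esub> inv\<^bsub>G\<^esub> h"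
      using surj[of "i u" "i v" "g \<otimes>\<^bsub>G\<^esub> inv\<^bsub>G\<^esub> h"] * by auto
    moreover from this main * have "((u, t A \<otimes>\<^bsub>G\<^esub> h), (v, h)) \<in> E" by blast
    ultimately show ?thesis using * by (simp add: G.m_assoc)
  qed
  then show "\<forall>u\<in>Obj \<Lambda> \<times> carrier G. \<forall>v\<in>Obj \<Lambda> \<times> carrier G. (u, v) \<in> E" by auto
qed


section \<open>Monodromy\<close>

text \<open>Bijections are represented by their graphs, so that inversion is \<open>converse\<close>.\<close>

definition bijection_groupoid :: "'i set \<Rightarrow> ('i \<Rightarrow> 's set) \<Rightarrow> ('i \<times> 's rel \<times> 'i) category" where
  "bijection_groupoid I X =
     \<lparr>Arr = {(u, R, v). u \<in> I \<and> v \<in> I \<and> R \<subseteq> X u \<times> X v \<and> R O R\<inverse> = Id_on (X u) \<and> R\<inverse> O R = Id_on (X v)},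
      Src = (\<lambda>(u, R, v). (v, Id_on (X v), v)),
      Rng = (\<lambda>(u, R, v). (u, Id_on (X u), u)),
      Cmp = (\<lambda>(u, R, v) (v', S, w). (u, R O S, w))\<rparr>"

text \<open>The two identities required of \<open>R\<close> say that it is the graph of a bijection
  and that its converse is a two-sided inverse. The work left is closure under composition, where
  the middle identity cancels.\<close>

lemma groupoid_bijection_groupoid: "groupoid (bijection_groupoid I X)"
proof -
  have id: "Id_on B O R = R" "R O Id_on D = R" if "R \<subseteq> B \<times> D" for B D and R :: "'c rel"
    using that by auto
  have comp: "(R O S) O (R O S)\<inverse> = Id_on B" "(R O S)\<inverse> O R O S = Id_on E"
    if "R O R\<inverse> = Id_on B" "R\<inverse> O R = Id_on D" "S O S\<inverse> = Id_on D" "S\<inverse> O S = Id_on E"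
      "R \<subseteq> B \<times> D" "S \<subseteq> D \<times> E" for B D E and R S :: "'c rel"
  proof -
    have D: "Id_on D O R\<inverse> = R\<inverse>" "Id_on D O S = S"
      using id(1)[of "R\<inverse>" D B] id(1)[of S D E] that(5,6) by blast+
    have "(R O S) O (R O S)\<inverse> = R O (S O S\<inverse>) O R\<inverse>" by (simp add: converse_relcomp O_assoc)
    also have "\<dots> = R O R\<inverse>" by (simp only: that D)
    finally show "(R O S) O (R O S)\<inverse> = Id_on B" using that by simp
    have "(R O S)\<inverse> O R O S = S\<inverse> O (R\<inverse> O R) O S" by (simp add: converse_relcomp O_assoc)
    also have "\<dots> = S\<inverse> O S" by (simp only: that D)
    finally show "(R O S)\<inverse> O R O S = Id_on E" using that by simp
  qed
  show ?thesis
  proof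
    fix a assume "a \<in> Arr (bijection_groupoid I X)"
    then show "\<exists>b\<in>Arr (bijection_groupoid I X).
        Src (bijection_groupoid I X) b = Rng (bijection_groupoid I X) a \<and>
        Rng (bijection_groupoid I X) b = Src (bijection_groupoid I X) a \<and>
        Cmp (bijection_groupoid I X) b a = Src (bijection_groupoid I X) a \<and>
        Cmp (bijection_groupoid I X) a b = Rng (bijection_groupoid I X) a"
      by (intro bexI[of _ "case a of (u, R, v) \<Rightarrow> (v, R\<inverse>, u)"]) (auto simp: bijection_groupoid_def)
  next
    fix a b
    assume "a \<in> Arr (bijection_groupoid I X)" "b \<in> Arr (bijection_groupoid I X)"
      "Src (bijection_groupoid I X) a = Rng (bijection_groupoid I X) b"
    then obtain u R v S w where "a = (u, R, v)" "b = (v, S, w)" "u \<in> I" "v \<in> I" "w \<in> I"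
      "R \<subseteq> X u \<times> X v" "R O R\<inverse> = Id_on (X u)" "R\<inverse> O R = Id_on (X v)"
      "S \<subseteq> X v \<times> X w" "S O S\<inverse> = Id_on (X v)" "S\<inverse> O S = Id_on (X w)"
      by (auto simp: bijection_groupoid_def)
    moreover from this have "R O S \<subseteq> X u \<times> X w" by blast
    ultimately show "Cmp (bijection_groupoid I X) a b \<in> Arr (bijection_groupoid I X)"
      using comp[of R "X u" "X v" S "X w"] by (simp add: bijection_groupoid_def)
  qed (auto simp: bijection_groupoid_def id O_assoc)
qed

section \<open>Unique lifting and the action on fibres\<close>

lemma covering_lift:
  assumes "covering k \<Lambda> \<Sigma> q" "\<alpha> \<in> Arr \<Lambda>" "w \<in> Obj \<Sigma>"
  shows "q w = Src \<Lambda> \<alpha> \<Longrightarrow> \<exists>!\<omega>. \<omega> \<in> Arr \<Sigma> \<and> Src \<Sigma> \<omega> = w \<and> q \<omega> = \<alpha>"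
    and "q w = Rng \<Lambda> \<alpha> \<Longrightarrow> \<exists>!\<omega>. \<omega> \<in> Arr \<Sigma> \<and> Rng \<Sigma> \<omega> = w \<and> q \<omega> = \<alpha>"
proof -
  have b: "bij_betw q {\<omega> \<in> Arr \<Sigma>. Src \<Sigma> \<omega> = w} {\<alpha> \<in> Arr \<Lambda>. Src \<Lambda> \<alpha> = q w}"
    "bij_betw q {\<omega> \<in> Arr \<Sigma>. Rng \<Sigma> \<omega> = w} {\<alpha> \<in> Arr \<Lambda>. Rng \<Lambda> \<alpha> = q w}"
    using assms by (auto simp: covering_def)
  have ex1: "\<exists>!\<omega>. \<omega> \<in> A \<and> q \<omega> = \<beta>" if "bij_betw q A B" "\<beta> \<in> B" for A B \<beta>
    using that by (auto simp: bij_betw_def inj_on_def)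
  show "\<exists>!\<omega>. \<omega> \<in> Arr \<Sigma> \<and> Src \<Sigma> \<omega> = w \<and> q \<omega> = \<alpha>" if "q w = Src \<Lambda> \<alpha>"
    using ex1[OF b(1), of \<alpha>] that assms(2) by (simp add: conj_assoc)
  show "\<exists>!\<omega>. \<omega> \<in> Arr \<Sigma> \<and> Rng \<Sigma> \<omega> = w \<and> q \<omega> = \<alpha>" if "q w = Rng \<Lambda> \<alpha>"
    using ex1[OF b(2), of \<alpha>] that assms(2) by (simp add: conj_assoc)
qed

text \<open>Lifting \<alpha> from every point over s(\<alpha>) gives a bijection of fibres,
  functorially in \<alpha>. This is a functor from \<Lambda> to a groupoid, so it extends to \<G>;
  \<open>\<rho> A\<close> is the graph of the resulting action of \<open>A\<close>.\<close>

lemma covering_monodromy: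
  assumes \<Lambda>: "k_graph k \<Lambda>" and fg: "fundamental_groupoid \<Lambda> \<G> i" and cov: "covering k \<Lambda> \<Sigma> q"
  obtains \<rho> where
    "\<And>A u v w. A \<in> Arr \<G> \<Longrightarrow> u \<in> Obj \<Lambda> \<Longrightarrow> v \<in> Obj \<Lambda> \<Longrightarrow> Rng \<G> A = i u \<Longrightarrow> Src \<G> A = i v \<Longrightarrow>
       w \<in> Obj \<Sigma> \<Longrightarrow> q w = v \<Longrightarrow> \<exists>!z. (z, w) \<in> \<rho> A"
    and "\<And>A u v z w. A \<in> Arr \<G> \<Longrightarrow> u \<in> Obj \<Lambda> \<Longrightarrow> v \<in> Obj \<Lambda> \<Longrightarrow> Rng \<G> A = i u \<Longrightarrow> Src \<G> A = i v \<Longrightarrow>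
       (z, w) \<in> \<rho> A \<Longrightarrow> z \<in> Obj \<Sigma> \<and> q z = u"
    and "\<And>A B. A \<in> Arr \<G> \<Longrightarrow> B \<in> Arr \<G> \<Longrightarrow> Src \<G> A = Rng \<G> B \<Longrightarrow> \<rho> (Cmp \<G> A B) = \<rho> A O \<rho> B"
    and "\<And>\<alpha>. \<alpha> \<in> Arr \<Lambda> \<Longrightarrow> \<rho> (i \<alpha>) = {(Rng \<Sigma> \<omega>, Src \<Sigma> \<omega>) |\<omega>. \<omega> \<in> Arr \<Sigma> \<and> q \<omega> = \<alpha>}"
proof -
  interpret \<Lambda>: k_graph k \<Lambda> by fact
  have "k_graph k \<Sigma>" and q: "is_functor \<Sigma> \<Lambda> q" using cov by (auto simp: covering_def kgraph_morphism_def)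
  interpret \<Sigma>: k_graph k \<Sigma> by fact
  have G: "groupoid \<G>" "is_functor \<Lambda> \<G> i" using fg by (auto simp: fundamental_groupoid_def)
  interpret groupoid \<G> by (rule G)
  note q = functorD[OF q]
  define X where "X u = {w \<in> Obj \<Sigma>. q w = u}" for u
  \<comment> \<open>Pairs list the range before the source, so that relational composition has the
    same order as composition of morphisms.\<close>
  define L where "L \<alpha> = {(Rng \<Sigma> \<omega>, Src \<Sigma> \<omega>) |\<omega>. \<omega> \<in> Arr \<Sigma> \<and> q \<omega> = \<alpha>}" for \<alpha>
  define F where "F \<alpha> = (Rng \<Lambda> \<alpha>, L \<alpha>, Src \<Lambda> \<alpha>)" for \<alpha>
  let ?B = "bijection_groupoid (Obj \<Lambda>) X"
  note lift = covering_lift[OF cov]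
  have L_obj: "L u = Id_on (X u)" if u: "u \<in> Obj \<Lambda>" for u
  proof -
    \<comment> \<open>A morphism over an identity is an identity: its source is another lift of
      \<open>u\<close> with the same source.\<close>
    have fib: "\<omega> \<in> Obj \<Sigma>" if "\<omega> \<in> Arr \<Sigma>" "q \<omega> = u" for \<omega>
    proof -
      have "Src \<Sigma> \<omega> \<in> Obj \<Sigma>" "q (Src \<Sigma> \<omega>) = u" "q (Src \<Sigma> \<omega>) = Src \<Lambda> u"
        using q(2) that \<Sigma>.ObjI \<Lambda>.ObjD[OF u] by auto
      from lift(1)[OF _ this(1,3)] this(2) \<Lambda>.ObjD[OF u] \<Sigma>.src_arr \<Sigma>.src_src
      have "\<omega> = Src \<Sigma> \<omega>" using that by metis
      then show ?thesis using that by (simp add: Obj_def)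
    qed
    show ?thesis
    proof (intro equalityI subrelI)
      fix a b assume "(a, b) \<in> L u"
      then obtain \<omega> where "\<omega> \<in> Arr \<Sigma>" "q \<omega> = u" "a = Rng \<Sigma> \<omega>" "b = Src \<Sigma> \<omega>" by (auto simp: L_def)
      with fib[of \<omega>] \<Sigma>.ObjD[of \<omega>] show "(a, b) \<in> Id_on (X u)" by (auto simp: X_def)
    next
      fix a b assume "(a, b) \<in> Id_on (X u)"
      then have "a = b" "a \<in> Obj \<Sigma>" "q a = u" by (auto simp: X_def)
      with \<Sigma>.ObjD[of a] show "(a, b) \<in> L u" by (force simp: L_def)
    qed
  qed
  have LX: "L \<alpha> \<subseteq> X (Rng \<Lambda> \<alpha>) \<times> X (Src \<Lambda> \<alpha>)" for \<alpha>
    using \<Sigma>.ObjI q(2,3) by (auto simp: L_def X_def)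
  have F: "is_functor \<Lambda> ?B F"
    unfolding is_functor_def
  proof (intro conjI ballI impI)
    fix \<alpha> assume \<alpha>: "\<alpha> \<in> Arr \<Lambda>"
    \<comment> \<open>Uniqueness of lifts with given source makes the relation single-valued as a
      map from the source fibre, and existence of lifts with given range makes it onto. The other
      composite exchanges source and range.\<close>
    have "L \<alpha> O (L \<alpha>)\<inverse> = Id_on (X (Rng \<Lambda> \<alpha>))"
    proof (intro equalityI subrelI)
      fix a b assume "(a, b) \<in> L \<alpha> O (L \<alpha>)\<inverse>"
      then obtain \<omega> \<omega>' where "\<omega> \<in> Arr \<Sigma>" "\<omega>' \<in> Arr \<Sigma>" "q \<omega> = \<alpha>" "q \<omega>' = \<alpha>" "Src \<Sigma> \<omega> = Src \<Sigma> \<omega>'"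
        "a = Rng \<Sigma> \<omega>" "b = Rng \<Sigma> \<omega>'" by (auto simp: L_def)
      moreover from this have "\<omega> = \<omega>'"
        using lift(1)[OF \<alpha>, of "Src \<Sigma> \<omega>"] \<Sigma>.ObjI q(2) by metis
      ultimately show "(a, b) \<in> Id_on (X (Rng \<Lambda> \<alpha>))" using \<Sigma>.ObjI q(3) by (auto simp: X_def)
    next
      fix a b assume "(a, b) \<in> Id_on (X (Rng \<Lambda> \<alpha>))"
      then have "a = b" "a \<in> Obj \<Sigma>" "q a = Rng \<Lambda> \<alpha>" by (auto simp: X_def)
      with lift(2)[OF \<alpha> this(2,3)] show "(a, b) \<in> L \<alpha> O (L \<alpha>)\<inverse>" by (auto simp: L_def)
    qed
    moreover have "(L \<alpha>)\<inverse> O L \<alpha> = Id_on (X (Src \<Lambda> \<alpha>))"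
    proof (intro equalityI subrelI)
      fix a b assume "(a, b) \<in> (L \<alpha>)\<inverse> O L \<alpha>"
      then obtain \<omega> \<omega>' where "\<omega> \<in> Arr \<Sigma>" "\<omega>' \<in> Arr \<Sigma>" "q \<omega> = \<alpha>" "q \<omega>' = \<alpha>" "Rng \<Sigma> \<omega> = Rng \<Sigma> \<omega>'"
        "a = Src \<Sigma> \<omega>" "b = Src \<Sigma> \<omega>'" by (auto simp: L_def)
      moreover from this have "\<omega> = \<omega>'"
        using lift(2)[OF \<alpha>, of "Rng \<Sigma> \<omega>"] \<Sigma>.ObjI q(3) by metis
      ultimately show "(a, b) \<in> Id_on (X (Src \<Lambda> \<alpha>))" using \<Sigma>.ObjI q(2) by (auto simp: X_def)
    next
      fix a b assume "(a, b) \<in> Id_on (X (Src \<Lambda> \<alpha>))"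
      then have "a = b" "a \<in> Obj \<Sigma>" "q a = Src \<Lambda> \<alpha>" by (auto simp: X_def)
      with lift(1)[OF \<alpha> this(2,3)] show "(a, b) \<in> (L \<alpha>)\<inverse> O L \<alpha>" by (auto simp: L_def)
    qed
    ultimately show "F \<alpha> \<in> Arr ?B"
      using LX \<Lambda>.ObjI[OF \<alpha>] by (simp add: F_def bijection_groupoid_def)
    show "F (Src \<Lambda> \<alpha>) = Src ?B (F \<alpha>)" "F (Rng \<Lambda> \<alpha>) = Rng ?B (F \<alpha>)"
      using L_obj \<Lambda>.ObjI[OF \<alpha>] \<Lambda>.ObjD by (simp_all add: F_def bijection_groupoid_def)
  next
    fix \<alpha> \<beta> assume \<alpha>: "\<alpha> \<in> Arr \<Lambda>" "\<beta> \<in> Arr \<Lambda>" "Src \<Lambda> \<alpha> = Rng \<Lambda> \<beta>"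
    have "L (Cmp \<Lambda> \<alpha> \<beta>) = L \<alpha> O L \<beta>"
    proof (intro equalityI subrelI)
      fix a b assume "(a, b) \<in> L \<alpha> O L \<beta>"
      then obtain \<omega> \<omega>' where "\<omega> \<in> Arr \<Sigma>" "\<omega>' \<in> Arr \<Sigma>" "q \<omega> = \<alpha>" "q \<omega>' = \<beta>" "Src \<Sigma> \<omega> = Rng \<Sigma> \<omega>'"
        "a = Rng \<Sigma> \<omega>" "b = Src \<Sigma> \<omega>'" by (auto simp: L_def)
      then show "(a, b) \<in> L (Cmp \<Lambda> \<alpha> \<beta>)"
        by (auto simp: L_def q \<Sigma>.cmp_arr \<Sigma>.src_cmp \<Sigma>.rng_cmp intro!: exI[of _ "Cmp \<Sigma> \<omega> \<omega>'"])
    next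
      fix a b assume "(a, b) \<in> L (Cmp \<Lambda> \<alpha> \<beta>)"
      then obtain \<omega> where \<omega>: "\<omega> \<in> Arr \<Sigma>" "q \<omega> = Cmp \<Lambda> \<alpha> \<beta>" "a = Rng \<Sigma> \<omega>" "b = Src \<Sigma> \<omega>"
        by (auto simp: L_def)
      \<comment> \<open>Lift \<beta> from \<open>b\<close>, then \<alpha> from the end of that lift.
        The composite has the same source and image as \<omega>, hence equals it.\<close>
      have "q b = Src \<Lambda> \<beta>" "b \<in> Obj \<Sigma>" using \<omega> \<alpha> q(2)[OF \<omega>(1)] \<Sigma>.ObjI by (auto simp: \<Lambda>.src_cmp)
      from lift(1)[OF \<alpha>(2) this(2,1)] obtain \<omega>2 where 2: "\<omega>2 \<in> Arr \<Sigma>" "Src \<Sigma> \<omega>2 = b" "q \<omega>2 = \<beta>" by blast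
      have "q (Rng \<Sigma> \<omega>2) = Src \<Lambda> \<alpha>" "Rng \<Sigma> \<omega>2 \<in> Obj \<Sigma>" using 2 \<alpha> q(3)[of \<omega>2] \<Sigma>.ObjI by auto
      from lift(1)[OF \<alpha>(1) this(2,1)] obtain \<omega>1 where 1: "\<omega>1 \<in> Arr \<Sigma>" "Src \<Sigma> \<omega>1 = Rng \<Sigma> \<omega>2" "q \<omega>1 = \<alpha>"
        by blast
      have "Cmp \<Sigma> \<omega>1 \<omega>2 \<in> Arr \<Sigma>" "q (Cmp \<Sigma> \<omega>1 \<omega>2) = Cmp \<Lambda> \<alpha> \<beta>" "Src \<Sigma> (Cmp \<Sigma> \<omega>1 \<omega>2) = b"
        using 1 2 by (simp_all add: q \<Sigma>.cmp_arr \<Sigma>.src_cmp)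
      then have "Cmp \<Sigma> \<omega>1 \<omega>2 = \<omega>"
        using lift(1)[OF \<Lambda>.cmp_arr[OF \<alpha>] \<open>b \<in> Obj \<Sigma>\<close>] \<omega> \<open>q b = Src \<Lambda> \<beta>\<close> \<Lambda>.src_cmp[OF \<alpha>] by metis
      then have "a = Rng \<Sigma> \<omega>1" using \<omega> 1 2 \<Sigma>.rng_cmp by metis
      then show "(a, b) \<in> L \<alpha> O L \<beta>" using 1 2 by (auto simp: L_def intro!: relcompI)
    qed
    then show "F (Cmp \<Lambda> \<alpha> \<beta>) = Cmp ?B (F \<alpha>) (F \<beta>)"
      using \<alpha> by (simp add: F_def bijection_groupoid_def \<Lambda>.src_cmp \<Lambda>.rng_cmp)
  qed
  from fundamental_groupoid_any_type[OF \<Lambda>.small_category_axioms fg groupoid_bijection_groupoid F]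
  obtain K where K: "is_functor \<G> ?B K" and KF: "\<And>\<alpha>. \<alpha> \<in> Arr \<Lambda> \<Longrightarrow> K (i \<alpha>) = F \<alpha>" by blast
  note K = functorD[OF K]
  define \<rho> where "\<rho> A = fst (snd (K A))" for A
  have KA: "K A = (u, \<rho> A, v)" and \<rho>: "\<rho> A \<subseteq> X u \<times> X v" "\<rho> A O (\<rho> A)\<inverse> = Id_on (X u)"
    "(\<rho> A)\<inverse> O \<rho> A = Id_on (X v)"
    if "A \<in> Arr \<G>" "u \<in> Obj \<Lambda>" "v \<in> Obj \<Lambda>" "Rng \<G> A = i u" "Src \<G> A = i v" for A u v
  proof -
    \<comment> \<open>The range and source of \<open>A\<close> are the identities \<open>i u\<close>
      and \<open>i v\<close>, on which \<open>K\<close> is already known from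
      \<open>F\<close>.\<close>
    have "Rng ?B (K A) = F u" "Src ?B (K A) = F v"
      using K(2,3)[OF that(1)] KF \<Lambda>.ObjD that by metis+
    then show KA: "K A = (u, \<rho> A, v)"
      using that(2,3) by (cases "K A") (simp add: bijection_groupoid_def F_def \<rho>_def \<Lambda>.ObjD)
    show "\<rho> A \<subseteq> X u \<times> X v" "\<rho> A O (\<rho> A)\<inverse> = Id_on (X u)" "(\<rho> A)\<inverse> O \<rho> A = Id_on (X v)"
      using K(1)[OF that(1)] by (simp_all add: KA bijection_groupoid_def)
  qed
  show thesis
  proof (rule that[of \<rho>])
    fix A u v w assume A: "A \<in> Arr \<G>" "u \<in> Obj \<Lambda>" "v \<in> Obj \<Lambda>" "Rng \<G> A = i u" "Src \<G> A = i v"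
      and "w \<in> Obj \<Sigma>" "q w = v"
    \<comment> \<open>Existence of the end point comes from the identity on the fibre over
      \<open>v\<close>, uniqueness from the one over \<open>u\<close>.\<close>
    then have "(w, w) \<in> (\<rho> A)\<inverse> O \<rho> A" unfolding \<rho>(3)[OF A] by (auto simp: X_def)
    moreover have "z = z'" if "(z, w) \<in> \<rho> A" "(z', w) \<in> \<rho> A" for z z'
      using relcompI[OF that(1) converseI[OF that(2)]] unfolding \<rho>(2)[OF A] by auto
    ultimately show "\<exists>!z. (z, w) \<in> \<rho> A" by blast
  next
    fix A u v z w
    assume "A \<in> Arr \<G>" "u \<in> Obj \<Lambda>" "v \<in> Obj \<Lambda>" "Rng \<G> A = i u" "Src \<G> A = i v" "(z, w) \<in> \<rho> A"
    then show "z \<in> Obj \<Sigma> \<and> q z = u" using \<rho>(1) by (fastforce simp: X_def)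
  next
    fix A B assume "A \<in> Arr \<G>" "B \<in> Arr \<G>" "Src \<G> A = Rng \<G> B"
    then show "\<rho> (Cmp \<G> A B) = \<rho> A O \<rho> B"
      by (simp add: \<rho>_def K(4)) (simp add: bijection_groupoid_def split: prod.split)
  next
    fix \<alpha> assume "\<alpha> \<in> Arr \<Lambda>"
    then show "\<rho> (i \<alpha>) = {(Rng \<Sigma> \<omega>, Src \<Sigma> \<omega>) |\<omega>. \<omega> \<in> Arr \<Sigma> \<and> q \<omega> = \<alpha>}"
      by (simp add: \<rho>_def KF F_def L_def)
  qed
qed

section \<open>The morphism from the skew product to a covering\<close>

text \<open>Sending (v, g) to \<gamma>(v) g \<cdot> w respects ranges because \<gamma>(r(\<alpha>))
  \<eta>(\<alpha>) g = i(\<alpha>) \<gamma>(s(\<alpha>)) g. Unique lifting then fixes the images of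
  all morphisms and makes them compose.\<close>

lemma skew_product_covering_morphism:
  fixes \<Lambda> :: "('a, 'b) kgraph_scheme" and \<G> :: "('g, 'c) category_scheme"
    and \<Sigma> :: "('s, 'd) kgraph_scheme"
  assumes \<Lambda>: "k_graph k \<Lambda>" and fg: "fundamental_groupoid \<Lambda> \<G> i" and cov: "covering k \<Lambda> \<Sigma> q"
    and x: "x \<in> Obj \<Lambda>"
    and \<gamma>: "\<forall>y \<in> Obj \<G>. \<gamma> y \<in> Arr \<G> \<and> Rng \<G> (\<gamma> y) = y \<and> Src \<G> (\<gamma> y) = i x"
  shows "\<exists>\<phi>. covering_morphism
    (skew_product \<Lambda> (vertex_group \<G> (i x)) (groupoid.retract_arr \<G> \<gamma> \<circ> i)) fst \<Sigma> q \<phi>"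
proof -
  interpret \<Lambda>: k_graph k \<Lambda> by fact
  have "k_graph k \<Sigma>" and q: "is_functor \<Sigma> \<Lambda> q" and qdeg: "\<And>\<omega>. \<omega> \<in> Arr \<Sigma> \<Longrightarrow> Deg \<Lambda> (q \<omega>) = Deg \<Sigma> \<omega>"
    and qsurj: "q ` Arr \<Sigma> = Arr \<Lambda>"
    using cov by (auto simp: covering_def kgraph_morphism_def)
  interpret \<Sigma>: k_graph k \<Sigma> by fact
  have G: "groupoid \<G>" "is_functor \<Lambda> \<G> i" and bij: "bij_betw i (Obj \<Lambda>) (Obj \<G>)"
    using fg by (auto simp: fundamental_groupoid_def)
  interpret groupoid \<G> by (rule G)
  note q = functorD[OF q] and i = functorD[OF G(2)]
  note lift = covering_lift(1)[OF cov]
  let ?G = "vertex_group \<G> (i x)" and ?\<eta> = "retract_arr \<gamma> \<circ> i"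
  let ?S = "skew_product \<Lambda> ?G ?\<eta>"
  obtain \<rho> where \<rho>:
    "\<And>A u v w. A \<in> Arr \<G> \<Longrightarrow> u \<in> Obj \<Lambda> \<Longrightarrow> v \<in> Obj \<Lambda> \<Longrightarrow> Rng \<G> A = i u \<Longrightarrow> Src \<G> A = i v \<Longrightarrow>
       w \<in> Obj \<Sigma> \<Longrightarrow> q w = v \<Longrightarrow> \<exists>!z. (z, w) \<in> \<rho> A"
    "\<And>A u v z w. A \<in> Arr \<G> \<Longrightarrow> u \<in> Obj \<Lambda> \<Longrightarrow> v \<in> Obj \<Lambda> \<Longrightarrow> Rng \<G> A = i u \<Longrightarrow> Src \<G> A = i v \<Longrightarrow>
       (z, w) \<in> \<rho> A \<Longrightarrow> z \<in> Obj \<Sigma> \<and> q z = u"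
    "\<And>A B. A \<in> Arr \<G> \<Longrightarrow> B \<in> Arr \<G> \<Longrightarrow> Src \<G> A = Rng \<G> B \<Longrightarrow> \<rho> (Cmp \<G> A B) = \<rho> A O \<rho> B"
    "\<And>\<alpha>. \<alpha> \<in> Arr \<Lambda> \<Longrightarrow> \<rho> (i \<alpha>) = {(Rng \<Sigma> \<omega>, Src \<Sigma> \<omega>) |\<omega>. \<omega> \<in> Arr \<Sigma> \<and> q \<omega> = \<alpha>}"
    by (rule covering_monodromy[OF \<Lambda> fg cov]) blast
  obtain w where w: "w \<in> Obj \<Sigma>" "q w = x"
  proof -
    \<comment> \<open>Surjectivity of \<open>q\<close> provides a morphism over \<open>x\<close>;
      its source is a vertex over \<open>x\<close>.\<close>
    obtain \<omega> where "\<omega> \<in> Arr \<Sigma>" "q \<omega> = x" using qsurj \<Lambda>.ObjD[OF x] by (metis imageE)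
    then show thesis using that[of "Src \<Sigma> \<omega>"] \<Sigma>.ObjI q(2) \<Lambda>.ObjD[OF x] by auto
  qed
  have iObj: "i v \<in> Obj \<G>" if "v \<in> Obj \<Lambda>" for v using bij that by (auto simp: bij_betw_def)
  have arr: "Cmp \<G> (\<gamma> (i v)) g \<in> Arr \<G>" "Rng \<G> (Cmp \<G> (\<gamma> (i v)) g) = i v"
    "Src \<G> (Cmp \<G> (\<gamma> (i v)) g) = i x"
    if "v \<in> Obj \<Lambda>" "g \<in> carrier ?G" for v g
    using bspec[OF \<gamma> iObj[OF that(1)]] that(2) by (auto simp: vertex_group_def cmp_arr src_cmp rng_cmp)
  \<comment> \<open>This is the vertex \<gamma>(v) g \<cdot> w, the end point of the monodromy
    action on \<open>w\<close>.\<close>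
  define base where "base v g = (THE z. (z, w) \<in> \<rho> (Cmp \<G> (\<gamma> (i v)) g))" for v g
  have base1: "\<exists>!z. (z, w) \<in> \<rho> (Cmp \<G> (\<gamma> (i v)) g)" if "v \<in> Obj \<Lambda>" "g \<in> carrier ?G" for v g
    by (rule \<rho>(1)[OF arr(1)[OF that] that(1) x arr(2,3)[OF that] w])
  have base: "(base v g, w) \<in> \<rho> (Cmp \<G> (\<gamma> (i v)) g)" "base v g \<in> Obj \<Sigma>" "q (base v g) = v"
    if "v \<in> Obj \<Lambda>" "g \<in> carrier ?G" for v g
  proof -
    show "(base v g, w) \<in> \<rho> (Cmp \<G> (\<gamma> (i v)) g)"
      unfolding base_def by (rule theI'[OF base1[OF that]])
    from \<rho>(2)[OF arr(1)[OF that] that(1) x arr(2,3)[OF that] this]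
    show "base v g \<in> Obj \<Sigma>" "q (base v g) = v" by auto
  qed
  define \<phi> where "\<phi> = (\<lambda>(\<alpha>, g). THE \<omega>. \<omega> \<in> Arr \<Sigma> \<and> Src \<Sigma> \<omega> = base (Src \<Lambda> \<alpha>) g \<and> q \<omega> = \<alpha>)"
  have \<phi>1: "\<exists>!\<omega>. \<omega> \<in> Arr \<Sigma> \<and> Src \<Sigma> \<omega> = base (Src \<Lambda> \<alpha>) g \<and> q \<omega> = \<alpha>"
    if "\<alpha> \<in> Arr \<Lambda>" "g \<in> carrier ?G" for \<alpha> g
    using that \<Lambda>.ObjI by (intro lift base)
  have \<phi>: "\<phi> (\<alpha>, g) \<in> Arr \<Sigma>" "Src \<Sigma> (\<phi> (\<alpha>, g)) = base (Src \<Lambda> \<alpha>) g" "q (\<phi> (\<alpha>, g)) = \<alpha>"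
    if "\<alpha> \<in> Arr \<Lambda>" "g \<in> carrier ?G" for \<alpha> g
    using theI'[OF \<phi>1[OF that]] by (auto simp: \<phi>_def)
  have \<phi>_eq: "\<phi> (\<alpha>, g) = \<omega>" if "\<alpha> \<in> Arr \<Lambda>" "g \<in> carrier ?G" "\<omega> \<in> Arr \<Sigma>"
    "Src \<Sigma> \<omega> = base (Src \<Lambda> \<alpha>) g" "q \<omega> = \<alpha>" for \<alpha> g \<omega>
    using \<phi>1[OF that(1,2)] \<phi>[OF that(1,2)] that(3-) by blast
  have \<phi>_obj: "\<phi> (v, g) = base v g" if "v \<in> Obj \<Lambda>" "g \<in> carrier ?G" for v g
    using that base[OF that] \<Sigma>.ObjD[OF base(2)[OF that]] \<Lambda>.ObjD[OF that(1)] by (intro \<phi>_eq) auto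
  have t: "retract_arr \<gamma> (i \<alpha>) \<in> carrier ?G" if "\<alpha> \<in> Arr \<Lambda>" for \<alpha>
    using functorD(1)[OF retract_arr_functor[OF \<gamma>] i(1)[OF that]] by (simp add: monoid_category_def)
  interpret G: group ?G by (rule group_vertex_group[OF iObj[OF x]])
  have \<phi>_rng: "Rng \<Sigma> (\<phi> (\<alpha>, g)) = base (Rng \<Lambda> \<alpha>) (Cmp \<G> (retract_arr \<gamma> (i \<alpha>)) g)"
    if a: "\<alpha> \<in> Arr \<Lambda>" "g \<in> carrier ?G" for \<alpha> g
  proof -
    have c: "Cmp \<G> (retract_arr \<gamma> (i \<alpha>)) g \<in> carrier ?G"
      using G.m_closed[OF t[OF a(1)] a(2)] by (simp add: vertex_group_def)
    note s = \<Lambda>.ObjI[OF a(1)]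
    \<comment> \<open>The lift is one step of the action of \<open>i \<alpha>\<close>. Composing it
      with the action that carries \<open>w\<close> to its source gives an arrow which
      \<open>retract_arr_lift\<close> rewrites into the one defining the base vertex at the
      range.\<close>
    have "(Rng \<Sigma> (\<phi> (\<alpha>, g)), base (Src \<Lambda> \<alpha>) g) \<in> \<rho> (i \<alpha>)"
      using \<phi>[OF a] a(1) by (auto simp: \<rho>(4))
    then have "(Rng \<Sigma> (\<phi> (\<alpha>, g)), w) \<in> \<rho> (Cmp \<G> (i \<alpha>) (Cmp \<G> (\<gamma> (i (Src \<Lambda> \<alpha>))) g))"
      using base(1)[OF s(1) a(2)] \<rho>(3)[of "i \<alpha>"] arr[OF s(1) a(2)] i[of \<alpha>] a by auto
    also have "Cmp \<G> (i \<alpha>) (Cmp \<G> (\<gamma> (i (Src \<Lambda> \<alpha>))) g) =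
        Cmp \<G> (\<gamma> (i (Rng \<Lambda> \<alpha>))) (Cmp \<G> (retract_arr \<gamma> (i \<alpha>)) g)"
      using retract_arr_lift[OF \<gamma> i(1)[OF a(1)] a(2)] i(2,3)[OF a(1)] by simp
    finally show ?thesis using base1[OF s(2) c] base(1)[OF s(2) c] by blast
  qed
  have "is_functor ?S \<Sigma> \<phi>"
    unfolding is_functor_def
  proof (intro conjI ballI impI)
    fix a assume "a \<in> Arr ?S"
    then obtain \<alpha> g where a: "a = (\<alpha>, g)" "\<alpha> \<in> Arr \<Lambda>" "g \<in> carrier ?G" by (auto simp: skew_product_simps)
    show "\<phi> a \<in> Arr \<Sigma>" using \<phi>(1) a by simp
    show "\<phi> (Src ?S a) = Src \<Sigma> (\<phi> a)"
      using a \<phi>(2)[OF a(2,3)] \<phi>_obj[OF \<Lambda>.ObjI(1)] by (simp add: skew_product_simps)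
    have "retract_arr \<gamma> (i \<alpha>) \<otimes>\<^bsub>?G\<^esub> g \<in> carrier ?G" using t a by simp
    then show "\<phi> (Rng ?S a) = Rng \<Sigma> (\<phi> a)"
      using a \<phi>_rng[OF a(2,3)] \<phi>_obj[OF \<Lambda>.ObjI(2)] by (simp add: skew_product_simps) (simp add: vertex_group_def)
  next
    fix a b assume "a \<in> Arr ?S" "b \<in> Arr ?S" and ab: "Src ?S a = Rng ?S b"
    then obtain \<alpha> h \<beta> g where a: "a = (\<alpha>, h)" "\<alpha> \<in> Arr \<Lambda>" "h \<in> carrier ?G"
      and b: "b = (\<beta>, g)" "\<beta> \<in> Arr \<Lambda>" "g \<in> carrier ?G" by (auto simp: skew_product_simps)
    have s: "Src \<Lambda> \<alpha> = Rng \<Lambda> \<beta>" "h = Cmp \<G> (retract_arr \<gamma> (i \<beta>)) g"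
      using ab by (auto simp: a b skew_product_simps vertex_group_def)
    note p = \<phi>[OF a(2,3)] \<phi>[OF b(2,3)]
    have c: "Src \<Sigma> (\<phi> a) = Rng \<Sigma> (\<phi> b)" using p \<phi>_rng[OF b(2,3)] s by (simp add: a b)
    \<comment> \<open>The composite of the two lifts is itself a lift of \<alpha>\<beta> starting at
      the base vertex for \<beta> and g, so \<open>\<phi>_eq\<close> identifies it with the image of
      the composite.\<close>
    show "\<phi> (Cmp ?S a b) = Cmp \<Sigma> (\<phi> a) (\<phi> b)"
      unfolding a(1) b(1) skew_product_simps using p c a b s
      by (intro \<phi>_eq) (simp_all add: \<Lambda>.cmp_arr \<Lambda>.src_cmp \<Sigma>.cmp_arr \<Sigma>.src_cmp q(4))
  qed
  then have "covering_morphism ?S fst \<Sigma> q \<phi>"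
    using \<phi> qdeg by (fastforce simp: covering_morphism_def kgraph_morphism_def skew_product_simps)
  then show ?thesis by blast
qed

section \<open>The universal skew-product covering\<close>

theorem corollary6p5:
  fixes k :: nat and \<Lambda> :: "'a kgraph" and \<G> :: "'g category" and i :: "'a \<Rightarrow> 'g" and x :: 'a
  assumes "k_graph k \<Lambda>"
    and "connected_category \<Lambda>"
    and "x \<in> Obj \<Lambda>"
    and "fundamental_groupoid \<Lambda> \<G> i"
  shows "\<exists>\<eta>. cocycle \<Lambda> (fundamental_group \<G> i x) \<eta> \<and>
    universal_covering k \<Lambda> (skew_product \<Lambda> (fundamental_group \<G> i x) \<eta>) fst"
proof -
  interpret \<Lambda>: k_graph k \<Lambda> by fact
  have G: "groupoid \<G>" "is_functor \<Lambda> \<G> i" "bij_betw i (Obj \<Lambda>) (Obj \<G>)"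
    using assms(4) by (auto simp: fundamental_groupoid_def)
  interpret groupoid \<G> by (rule G)
  have ix: "i x \<in> Obj \<G>" using G(3) assms(3) by (auto simp: bij_betw_def)
  \<comment> \<open>Connectedness of \<Lambda> enters through these arrows; one is chosen for each
    object independently.\<close>
  have "\<forall>y \<in> Obj \<G>. \<exists>A. A \<in> Arr \<G> \<and> Rng \<G> A = y \<and> Src \<G> A = i x"
    using fundamental_groupoid_connected[OF \<Lambda>.small_category_axioms assms(2,4) _ ix] by metis
  then obtain \<gamma> where \<gamma>: "\<forall>y \<in> Obj \<G>. \<gamma> y \<in> Arr \<G> \<and> Rng \<G> (\<gamma> y) = y \<and> Src \<G> (\<gamma> y) = i x"
    by metis
  let ?G = "vertex_group \<G> (i x)" and ?\<eta> = "retract_arr \<gamma> \<circ> i"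
  note t = retract_arr_functor[OF \<gamma>]
  have grp: "group ?G" using ix by (rule group_vertex_group)
  have \<eta>: "cocycle \<Lambda> ?G ?\<eta>"
    using grp functor_comp[OF G(2) t] by (simp add: cocycle_def)
  moreover have "connected_category (skew_product \<Lambda> ?G ?\<eta>)"
    by (rule connected_skew_product[OF \<Lambda>.small_category_axioms assms(4) grp t])
      (metis retract_arr_surj[OF \<gamma>])
  moreover have "\<exists>\<phi>. covering_morphism (skew_product \<Lambda> ?G ?\<eta>) fst \<Sigma> q \<phi>"
    if "connected_covering k \<Lambda> \<Sigma> q" for \<Sigma> :: "'a signed_word kgraph" and q
    using that
    by (intro skew_product_covering_morphism[OF assms(1,4) _ assms(3) \<gamma>])
      (simp add: connected_covering_def)
  ultimately have "universal_covering k \<Lambda> (skew_product \<Lambda> ?G ?\<eta>) fst"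
    using covering_skew_product[OF assms(1) \<eta>]
    unfolding universal_covering_def connected_covering_def by blast
  with \<eta> show ?thesis unfolding fundamental_group_def by blast
qed

end
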